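(* Let $F=(f,f_2,f_3,\ldots):(A',\partial,\boldsymbol\mu')\to(A'',\partial,\boldsymbol\mu'')$ be an $A_\infty$-morphism and $g:(A',\partial)\to(A'',\partial)$ a chain map which is chain homotopic to the linear part $f$ of $F$. Then $g$ can be extended to an $A_\infty$-morphism $G=(g,g_2,g_3,\ldots):(A',\partial,\boldsymbol\mu')\to(A'',\partial,\boldsymbol\mu'')$ which is, moreover, $A_\infty$-homotopic to $F$.
   Context: Fix an arbitrary commutative unital ring $R$; all modules are over $R$ and $\otimes$ is over $R$. Chain complexes $(A,\partial)$ are $\mathbb{Z}$-graded, possibly unbounded, with differential of degree $-1$; the symbol $\partial$ is used for all differentials. For a graded module $A$, $T^c(\uparrow A)=\bigoplus_{n\ge1}(\uparrow A)^{\otimes n}$ is the tensor coalgebra (deconcatenation coproduct) on the suspension of $A$. An $A_\infty$-algebra $(A,\partial,\boldsymbol\mu)$ is a chain complex $(A,\partial)$ with linear maps $\mu_k:A^{\otimes k}\to A$, $k\ge2$, of degree $k-2$, such that the degree $-1$ coderivation $\delta$ of $T^c(\uparrow A)$ determined (after the usual suspension) by $\partial,\mu_2,\mu_3,\ldots$ satisfies $\delta^2=0$. An $A_\infty$-morphism $F=(f,f_2,f_3,\ldots):(A',\partial,\boldsymbol\mu')\to(A'',\partial,\boldsymbol\mu'')$ consists of linear maps $f:A'\to A''$ of degree $0$ and $f_k:A'^{\otimes k}\to A''$ of degree $k-1$, $k\ge 2$, such that the coalgebra morphism $\phi:T^c(\uparrow A')\to T^c(\uparrow A'')$ they determine satisfies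 $\delta''\phi=\phi\delta'$. Then $f$ is a chain map, called the linear part of $F$, and $F$ is said to extend $f$. An $A_\infty$-homotopy between $G=(g,g_2,\ldots)$ and $F=(f,f_2,\ldots)$ is a family $h:A'\to A''$ of degree $1$, $h_k:A'^{\otimes k}\to A''$ of degree $k$ ($k\geq 2$), whose associated degree $+1$ map $\eta:T^c(\uparrow A')\to T^c(\uparrow A'')$ satisfying $\Delta''\eta=(\phi\otimes\eta)\Delta'+(\eta\otimes\psi)\Delta'$ fulfills $\psi-\phi=\delta''\eta+\eta\delta'$, where $\phi,\psi$ are the coalgebra morphisms of $F,G$ and $\Delta',\Delta''$ are the coproducts. *)

theory Defs
  imports Complex_Main "HOL-Library.Poly_Mapping"
begin

text \<open>The free module on a type of generators consists of the finitely supported functions.\<close>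

definition fscale :: "'r::comm_ring_1 \<Rightarrow> ('x \<Rightarrow>\<^sub>0 'r) \<Rightarrow> ('x \<Rightarrow>\<^sub>0 'r)" where
  "fscale c p = Poly_Mapping.map ((*) c) p"

abbreviation gen :: "'x \<Rightarrow> ('x \<Rightarrow>\<^sub>0 'r::comm_ring_1)" where
  "gen w \<equiv> Poly_Mapping.single w 1"

lemma lookup_fscale: "Poly_Mapping.lookup (fscale c p) w = c * Poly_Mapping.lookup p w"
  by (simp add: fscale_def Poly_Mapping.map.rep_eq when_def)

interpretation free: module "fscale :: 'r::comm_ring_1 \<Rightarrow> ('x \<Rightarrow>\<^sub>0 'r) \<Rightarrow> ('x \<Rightarrow>\<^sub>0 'r)"
  by unfold_locales (auto intro!: poly_mapping_eqI simp: lookup_fscale lookup_add algebra_simps)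

definition lin_ext :: "('r::comm_ring_1 \<Rightarrow> 'b \<Rightarrow> 'b) \<Rightarrow> ('x \<Rightarrow> 'b::ab_group_add) \<Rightarrow> ('x \<Rightarrow>\<^sub>0 'r) \<Rightarrow> 'b" where
  "lin_ext s g p = (\<Sum>w\<in>Poly_Mapping.keys p. s (Poly_Mapping.lookup p w) (g w))"

text \<open>A \<open>\<int>\<close>-graded module is given by its total module (the whole type, with scalar
  multiplication \<open>s\<close>) and the family \<open>A\<close> of its homogeneous parts, of which it is the direct sum.\<close>

definition decomposes :: "(int \<Rightarrow> 'a::ab_group_add set) \<Rightarrow> 'a \<Rightarrow> (int \<Rightarrow> 'a) \<Rightarrow> bool" where
  "decomposes A x c \<longleftrightarrow> finite {n. c n \<noteq> 0} \<and> (\<forall>n. c n \<in> A n) \<and> x = (\<Sum>n | c n \<noteq> 0. c n)"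

locale graded_module = module s
  for s :: "'r::comm_ring_1 \<Rightarrow> 'a::ab_group_add \<Rightarrow> 'a" +
  fixes A :: "int \<Rightarrow> 'a set"
  assumes homogeneous_subspace: "subspace (A n)"
    and direct_sum: "\<exists>!c. decomposes A x c"

text \<open>\<open>parity A\<close> multiplies the elements of degree \<open>n\<close> by \<open>(-1)\<^sup>n\<close>.\<close>

definition parity :: "(int \<Rightarrow> 'a::ab_group_add set) \<Rightarrow> 'a \<Rightarrow> 'a" where
  "parity A x = (let c = (THE c. decomposes A x c) in \<Sum>n | c n \<noteq> 0. if even n then c n else - c n)"

definition graded_map ::
  "('r::comm_ring_1 \<Rightarrow> 'a::ab_group_add \<Rightarrow> 'a) \<Rightarrow> (int \<Rightarrow> 'a set) \<Rightarrow>
   ('r \<Rightarrow> 'b::ab_group_add \<Rightarrow> 'b) \<Rightarrow> (int \<Rightarrow> 'b set) \<Rightarrow> int \<Rightarrow> ('a \<Rightarrow> 'b) \<Rightarrow> bool" where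
  "graded_map sA A sB B d f \<longleftrightarrow> module_hom sA sB f \<and> (\<forall>n. f ` A n \<subseteq> B (n + d))"

definition chain_complex ::
  "('r::comm_ring_1 \<Rightarrow> 'a::ab_group_add \<Rightarrow> 'a) \<Rightarrow> (int \<Rightarrow> 'a set) \<Rightarrow> ('a \<Rightarrow> 'a) \<Rightarrow> bool" where
  "chain_complex s A d \<longleftrightarrow> graded_module s A \<and> graded_map s A s A (-1) d \<and> (\<forall>x. d (d x) = 0)"

definition chain_map ::
  "('r::comm_ring_1 \<Rightarrow> 'a::ab_group_add \<Rightarrow> 'a) \<Rightarrow> (int \<Rightarrow> 'a set) \<Rightarrow> ('a \<Rightarrow> 'a) \<Rightarrow>
   ('r \<Rightarrow> 'b::ab_group_add \<Rightarrow> 'b) \<Rightarrow> (int \<Rightarrow> 'b set) \<Rightarrow> ('b \<Rightarrow> 'b) \<Rightarrow> ('a \<Rightarrow> 'b) \<Rightarrow> bool" where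
  "chain_map sA A dA sB B dB f \<longleftrightarrow> graded_map sA A sB B 0 f \<and> (\<forall>x. dB (f x) = f (dA x))"

definition chain_homotopic ::
  "('r::comm_ring_1 \<Rightarrow> 'a::ab_group_add \<Rightarrow> 'a) \<Rightarrow> (int \<Rightarrow> 'a set) \<Rightarrow> ('a \<Rightarrow> 'a) \<Rightarrow>
   ('r \<Rightarrow> 'b::ab_group_add \<Rightarrow> 'b) \<Rightarrow> (int \<Rightarrow> 'b set) \<Rightarrow> ('b \<Rightarrow> 'b) \<Rightarrow> ('a \<Rightarrow> 'b) \<Rightarrow> ('a \<Rightarrow> 'b) \<Rightarrow> bool" where
  "chain_homotopic sA A dA sB B dB g f \<longleftrightarrow>
     (\<exists>h. graded_map sA A sB B 1 h \<and> (\<forall>x. g x - f x = dB (h x) + h (dA x)))"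

text \<open>Linear maps out of the \<open>k\<close>-th tensor power are given as \<open>k\<close>-linear maps, that is, as functions
  on lists of which only the values on lists of length \<open>k\<close> matter.\<close>

definition homogeneous_word :: "(int \<Rightarrow> 'a set) \<Rightarrow> int list \<Rightarrow> 'a list \<Rightarrow> bool" where
  "homogeneous_word A ns xs \<longleftrightarrow> list_all2 (\<lambda>n x. x \<in> A n) ns xs"

definition graded_multilinear ::
  "('r::comm_ring_1 \<Rightarrow> 'a::ab_group_add \<Rightarrow> 'a) \<Rightarrow> (int \<Rightarrow> 'a set) \<Rightarrow>
   ('r \<Rightarrow> 'b::ab_group_add \<Rightarrow> 'b) \<Rightarrow> (int \<Rightarrow> 'b set) \<Rightarrow> nat \<Rightarrow> int \<Rightarrow> ('a list \<Rightarrow> 'b) \<Rightarrow> bool" where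
  "graded_multilinear sA A sB B k d m \<longleftrightarrow>
     (\<forall>xs ys. length xs + 1 + length ys = k \<longrightarrow> module_hom sA sB (\<lambda>x. m (xs @ [x] @ ys))) \<and>
     (\<forall>ns xs. length xs = k \<longrightarrow> homogeneous_word A ns xs \<longrightarrow> m xs \<in> B (sum_list ns + d))"

text \<open>The tensor coalgebra on the suspension of \<open>A\<close> is the quotient of the free module on words
  in \<open>A\<close> by the submodule \<open>tc_rel\<close>: the word \<open>[a\<^sub>1, \<dots>, a\<^sub>n]\<close> represents the tensor
  \<open>\<up>a\<^sub>1 \<otimes> \<dots> \<otimes> \<up>a\<^sub>n\<close>, and the empty word is killed since only \<open>n \<ge> 1\<close> occurs.
  We compute with representatives: linear maps of tensor coalgebras are represented by linear maps
  of the free modules that respect \<open>tc_rel\<close>, and equality is congruence modulo \<open>tc_rel\<close>.\<close>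

definition tc_rel :: "('r::comm_ring_1 \<Rightarrow> 'a::ab_group_add \<Rightarrow> 'a) \<Rightarrow> ('a list \<Rightarrow>\<^sub>0 'r) set" where
  "tc_rel s = free.span
     ({gen []}
      \<union> {gen (xs @ [x + y] @ ys) - gen (xs @ [x] @ ys) - gen (xs @ [y] @ ys) | xs x y ys. True}
      \<union> {gen (xs @ [s c x] @ ys) - fscale c (gen (xs @ [x] @ ys)) | xs c x ys. True})"

text \<open>Representatives of the elements of degree \<open>d\<close>; the degree of \<open>\<up>a\<close> is one more than
  that of \<open>a\<close>.\<close>

definition tc_deg ::
  "('r::comm_ring_1 \<Rightarrow> 'a::ab_group_add \<Rightarrow> 'a) \<Rightarrow> (int \<Rightarrow> 'a set) \<Rightarrow> int \<Rightarrow> ('a list \<Rightarrow>\<^sub>0 'r) set" where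
  "tc_deg s A d =
     {x. \<exists>y \<in> free.span {gen xs | xs ns. homogeneous_word A ns xs \<and> (\<Sum>n\<leftarrow>ns. n + 1) = d}.
           x - y \<in> tc_rel s}"

definition tc_map ::
  "('r::comm_ring_1 \<Rightarrow> 'a::ab_group_add \<Rightarrow> 'a) \<Rightarrow> (int \<Rightarrow> 'a set) \<Rightarrow>
   ('r \<Rightarrow> 'b::ab_group_add \<Rightarrow> 'b) \<Rightarrow> (int \<Rightarrow> 'b set) \<Rightarrow> int \<Rightarrow>
   (('a list \<Rightarrow>\<^sub>0 'r) \<Rightarrow> ('b list \<Rightarrow>\<^sub>0 'r)) \<Rightarrow> bool" where
  "tc_map sA A sB B d \<theta> \<longleftrightarrow>
     module_hom fscale fscale \<theta> \<and> \<theta> ` tc_rel sA \<subseteq> tc_rel sB \<and>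
     (\<forall>n. \<theta> ` tc_deg sA A n \<subseteq> tc_deg sB B (n + d))"

definition tens :: "('x \<Rightarrow>\<^sub>0 'r::comm_ring_1) \<Rightarrow> ('y \<Rightarrow>\<^sub>0 'r) \<Rightarrow> ('x \<times> 'y \<Rightarrow>\<^sub>0 'r)" where
  "tens x y = lin_ext fscale (\<lambda>u. lin_ext fscale (\<lambda>v. gen (u, v)) y) x"

text \<open>The tensor square of the tensor coalgebra is the free module on pairs of words modulo
  \<open>tc2_rel\<close>.\<close>

definition tc2_rel ::
  "('r::comm_ring_1 \<Rightarrow> 'a::ab_group_add \<Rightarrow> 'a) \<Rightarrow> ('a list \<times> 'a list \<Rightarrow>\<^sub>0 'r) set" where
  "tc2_rel s = free.span ({tens r x | r x. r \<in> tc_rel s} \<union> {tens x r | x r. r \<in> tc_rel s})"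

definition deconc :: "('a list \<Rightarrow>\<^sub>0 'r::comm_ring_1) \<Rightarrow> ('a list \<times> 'a list \<Rightarrow>\<^sub>0 'r)" where
  "deconc = lin_ext fscale (\<lambda>w. \<Sum>i = 1..<length w. gen (take i w, drop i w))"

text \<open>\<open>tmap A d p q\<close> is \<open>p \<otimes> q\<close> for \<open>q\<close> of degree \<open>d\<close>, with the Koszul rule
  \<open>(p \<otimes> q) (x \<otimes> y) = (-1)\<^bsup>|q| |x|\<^esup> p x \<otimes> q y\<close>. On \<open>\<up>a\<close> the sign
  \<open>(-1)\<^bsup>|\<up>a|\<^esup>\<close> is realised by \<open>- parity A a\<close>.\<close>

definition tmap ::
  "(int \<Rightarrow> 'a::ab_group_add set) \<Rightarrow> int \<Rightarrow>
   (('a list \<Rightarrow>\<^sub>0 'r::comm_ring_1) \<Rightarrow> ('b list \<Rightarrow>\<^sub>0 'r)) \<Rightarrow> (('a list \<Rightarrow>\<^sub>0 'r) \<Rightarrow> ('b list \<Rightarrow>\<^sub>0 'r)) \<Rightarrow>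
   ('a list \<times> 'a list \<Rightarrow>\<^sub>0 'r) \<Rightarrow> ('b list \<times> 'b list \<Rightarrow>\<^sub>0 'r)" where
  "tmap A d p q = lin_ext fscale
     (\<lambda>(u, v). tens (p (gen (if even d then u else map (\<lambda>a. - parity A a) u))) (q (gen v)))"

definition tc_coderivation ::
  "('r::comm_ring_1 \<Rightarrow> 'a::ab_group_add \<Rightarrow> 'a) \<Rightarrow> (int \<Rightarrow> 'a set) \<Rightarrow>
   (('a list \<Rightarrow>\<^sub>0 'r) \<Rightarrow> ('a list \<Rightarrow>\<^sub>0 'r)) \<Rightarrow> bool" where
  "tc_coderivation s A \<delta> \<longleftrightarrow>
     tc_map s A s A (-1) \<delta> \<and>
     (\<forall>x. deconc (\<delta> x) - (tmap A 0 \<delta> id (deconc x) + tmap A (-1) id \<delta> (deconc x)) \<in> tc2_rel s)"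

definition tc_morphism ::
  "('r::comm_ring_1 \<Rightarrow> 'a::ab_group_add \<Rightarrow> 'a) \<Rightarrow> (int \<Rightarrow> 'a set) \<Rightarrow>
   ('r \<Rightarrow> 'b::ab_group_add \<Rightarrow> 'b) \<Rightarrow> (int \<Rightarrow> 'b set) \<Rightarrow>
   (('a list \<Rightarrow>\<^sub>0 'r) \<Rightarrow> ('b list \<Rightarrow>\<^sub>0 'r)) \<Rightarrow> bool" where
  "tc_morphism sA A sB B \<phi> \<longleftrightarrow>
     tc_map sA A sB B 0 \<phi> \<and>
     (\<forall>x. deconc (\<phi> x) - tmap A 0 \<phi> \<phi> (deconc x) \<in> tc2_rel sB)"

definition tc_homotopy ::
  "('r::comm_ring_1 \<Rightarrow> 'a::ab_group_add \<Rightarrow> 'a) \<Rightarrow> (int \<Rightarrow> 'a set) \<Rightarrow>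
   ('r \<Rightarrow> 'b::ab_group_add \<Rightarrow> 'b) \<Rightarrow> (int \<Rightarrow> 'b set) \<Rightarrow>
   (('a list \<Rightarrow>\<^sub>0 'r) \<Rightarrow> ('b list \<Rightarrow>\<^sub>0 'r)) \<Rightarrow> (('a list \<Rightarrow>\<^sub>0 'r) \<Rightarrow> ('b list \<Rightarrow>\<^sub>0 'r)) \<Rightarrow>
   (('a list \<Rightarrow>\<^sub>0 'r) \<Rightarrow> ('b list \<Rightarrow>\<^sub>0 'r)) \<Rightarrow> bool" where
  "tc_homotopy sA A sB B \<phi> \<psi> \<eta> \<longleftrightarrow>
     tc_map sA A sB B 1 \<eta> \<and>
     (\<forall>x. deconc (\<eta> x) - (tmap A 1 \<phi> \<eta> (deconc x) + tmap A 0 \<eta> \<psi> (deconc x)) \<in> tc2_rel sB)"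

definition tc_proj :: "('r::comm_ring_1 \<Rightarrow> 'a::ab_group_add \<Rightarrow> 'a) \<Rightarrow> ('a list \<Rightarrow>\<^sub>0 'r) \<Rightarrow> 'a" where
  "tc_proj s = lin_ext s (\<lambda>w. if length w = 1 then hd w else 0)"

text \<open>The corestriction of \<open>\<theta>\<close> to the cogenerators has the components
  \<open>\<up> \<circ> m\<^sub>k \<circ> \<down>\<^bsup>\<otimes>k\<^esup>\<close>, \<open>k \<ge> 1\<close>; by the Koszul rule,
  \<open>\<down>\<^bsup>\<otimes>k\<^esup> (\<up>a\<^sub>1 \<otimes> \<dots> \<otimes> \<up>a\<^sub>k)\<close> is \<open>a\<^sub>1 \<otimes> \<dots> \<otimes> a\<^sub>k\<close> with
  sign exponent \<open>\<Sum>i. (k - i) (|a\<^sub>i| + 1)\<close>.\<close>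

definition desusp_exponent :: "int list \<Rightarrow> int" where
  "desusp_exponent ns = (\<Sum>i<length ns. int (length ns - 1 - i) * (ns ! i + 1))"

definition has_components ::
  "(int \<Rightarrow> 'a::ab_group_add set) \<Rightarrow> ('r::comm_ring_1 \<Rightarrow> 'b::ab_group_add \<Rightarrow> 'b) \<Rightarrow>
   (('a list \<Rightarrow>\<^sub>0 'r) \<Rightarrow> ('b list \<Rightarrow>\<^sub>0 'r)) \<Rightarrow> (nat \<Rightarrow> 'a list \<Rightarrow> 'b) \<Rightarrow> bool" where
  "has_components A sB \<theta> m \<longleftrightarrow>
     (\<forall>ns xs. xs \<noteq> [] \<longrightarrow> homogeneous_word A ns xs \<longrightarrow>
        tc_proj sB (\<theta> (gen xs)) =
          (if even (desusp_exponent ns) then m (length xs) xs else - m (length xs) xs))"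

text \<open>\<open>family f fs\<close> is the sequence \<open>(f, f\<^sub>2, f\<^sub>3, \<dots>)\<close>; the values \<open>fs 0\<close> and \<open>fs 1\<close>
  are irrelevant.\<close>

definition family :: "('a \<Rightarrow> 'b) \<Rightarrow> (nat \<Rightarrow> 'a list \<Rightarrow> 'b) \<Rightarrow> nat \<Rightarrow> 'a list \<Rightarrow> 'b" where
  "family f fs k xs = (if k = 1 then f (hd xs) else fs k xs)"

text \<open>Coderivations, coalgebra morphisms and the maps in \<open>tc_homotopy\<close> are determined, modulo
  \<open>tc_rel\<close>, by their components, so the existential quantifiers below merely refer to the maps
  determined by the given families.\<close>

definition determined_coderivation ::
  "('r::comm_ring_1 \<Rightarrow> 'a::ab_group_add \<Rightarrow> 'a) \<Rightarrow> (int \<Rightarrow> 'a set) \<Rightarrow> ('a \<Rightarrow> 'a) \<Rightarrow>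
   (nat \<Rightarrow> 'a list \<Rightarrow> 'a) \<Rightarrow> (('a list \<Rightarrow>\<^sub>0 'r) \<Rightarrow> ('a list \<Rightarrow>\<^sub>0 'r)) \<Rightarrow> bool" where
  "determined_coderivation s A d \<mu> \<delta> \<longleftrightarrow> tc_coderivation s A \<delta> \<and> has_components A s \<delta> (family d \<mu>)"

definition determined_morphism ::
  "('r::comm_ring_1 \<Rightarrow> 'a::ab_group_add \<Rightarrow> 'a) \<Rightarrow> (int \<Rightarrow> 'a set) \<Rightarrow>
   ('r \<Rightarrow> 'b::ab_group_add \<Rightarrow> 'b) \<Rightarrow> (int \<Rightarrow> 'b set) \<Rightarrow> ('a \<Rightarrow> 'b) \<Rightarrow>
   (nat \<Rightarrow> 'a list \<Rightarrow> 'b) \<Rightarrow> (('a list \<Rightarrow>\<^sub>0 'r) \<Rightarrow> ('b list \<Rightarrow>\<^sub>0 'r)) \<Rightarrow> bool" where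
  "determined_morphism sA A sB B f fs \<phi> \<longleftrightarrow>
     tc_morphism sA A sB B \<phi> \<and> has_components A sB \<phi> (family f fs)"

definition A_inf_algebra ::
  "('r::comm_ring_1 \<Rightarrow> 'a::ab_group_add \<Rightarrow> 'a) \<Rightarrow> (int \<Rightarrow> 'a set) \<Rightarrow> ('a \<Rightarrow> 'a) \<Rightarrow>
   (nat \<Rightarrow> 'a list \<Rightarrow> 'a) \<Rightarrow> bool" where
  "A_inf_algebra s A d \<mu> \<longleftrightarrow>
     chain_complex s A d \<and>
     (\<forall>k\<ge>2. graded_multilinear s A s A k (int k - 2) (\<mu> k)) \<and>
     (\<exists>\<delta>. determined_coderivation s A d \<mu> \<delta> \<and> (\<forall>x. \<delta> (\<delta> x) \<in> tc_rel s))"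

definition A_inf_morphism ::
  "('r::comm_ring_1 \<Rightarrow> 'a::ab_group_add \<Rightarrow> 'a) \<Rightarrow> (int \<Rightarrow> 'a set) \<Rightarrow> ('a \<Rightarrow> 'a) \<Rightarrow> (nat \<Rightarrow> 'a list \<Rightarrow> 'a) \<Rightarrow>
   ('r \<Rightarrow> 'b::ab_group_add \<Rightarrow> 'b) \<Rightarrow> (int \<Rightarrow> 'b set) \<Rightarrow> ('b \<Rightarrow> 'b) \<Rightarrow> (nat \<Rightarrow> 'b list \<Rightarrow> 'b) \<Rightarrow>
   ('a \<Rightarrow> 'b) \<Rightarrow> (nat \<Rightarrow> 'a list \<Rightarrow> 'b) \<Rightarrow> bool" where
  "A_inf_morphism sA A dA \<mu>A sB B dB \<mu>B f fs \<longleftrightarrow>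
     graded_map sA A sB B 0 f \<and>
     (\<forall>k\<ge>2. graded_multilinear sA A sB B k (int k - 1) (fs k)) \<and>
     (\<exists>\<delta>A \<delta>B \<phi>. determined_coderivation sA A dA \<mu>A \<delta>A \<and> determined_coderivation sB B dB \<mu>B \<delta>B \<and>
        determined_morphism sA A sB B f fs \<phi> \<and>
        (\<forall>x. \<delta>B (\<phi> x) - \<phi> (\<delta>A x) \<in> tc_rel sB))"

definition A_inf_homotopy ::
  "('r::comm_ring_1 \<Rightarrow> 'a::ab_group_add \<Rightarrow> 'a) \<Rightarrow> (int \<Rightarrow> 'a set) \<Rightarrow> ('a \<Rightarrow> 'a) \<Rightarrow> (nat \<Rightarrow> 'a list \<Rightarrow> 'a) \<Rightarrow>
   ('r \<Rightarrow> 'b::ab_group_add \<Rightarrow> 'b) \<Rightarrow> (int \<Rightarrow> 'b set) \<Rightarrow> ('b \<Rightarrow> 'b) \<Rightarrow> (nat \<Rightarrow> 'b list \<Rightarrow> 'b) \<Rightarrow>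
   ('a \<Rightarrow> 'b) \<Rightarrow> (nat \<Rightarrow> 'a list \<Rightarrow> 'b) \<Rightarrow> ('a \<Rightarrow> 'b) \<Rightarrow> (nat \<Rightarrow> 'a list \<Rightarrow> 'b) \<Rightarrow>
   ('a \<Rightarrow> 'b) \<Rightarrow> (nat \<Rightarrow> 'a list \<Rightarrow> 'b) \<Rightarrow> bool" where
  "A_inf_homotopy sA A dA \<mu>A sB B dB \<mu>B g gs f fs h hs \<longleftrightarrow>
     graded_map sA A sB B 1 h \<and>
     (\<forall>k\<ge>2. graded_multilinear sA A sB B k (int k) (hs k)) \<and>
     (\<exists>\<delta>A \<delta>B \<phi> \<psi> \<eta>.
        determined_coderivation sA A dA \<mu>A \<delta>A \<and> determined_coderivation sB B dB \<mu>B \<delta>B \<and>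
        determined_morphism sA A sB B f fs \<phi> \<and> determined_morphism sA A sB B g gs \<psi> \<and>
        tc_homotopy sA A sB B \<phi> \<psi> \<eta> \<and> has_components A sB \<eta> (family h hs) \<and>
        (\<forall>x. (\<psi> x - \<phi> x) - (\<delta>B (\<eta> x) + \<eta> (\<delta>A x)) \<in> tc_rel sB))"

end

theory Submission
  imports Defs
begin

text \<open>
  Let \<open>h\<close> be a chain homotopy with \<open>g - f = \<partial> h + h \<partial>\<close>. The homotopy that is built has the
  components \<open>(h, 0, 0, \<dots>)\<close>. A map \<open>\<eta>\<close> with \<open>\<Delta> \<eta> = (\<phi> \<otimes> \<eta> + \<eta> \<otimes> \<psi>) \<Delta>\<close> and these components sends
  a word to the sum of its decompositions into blocks, where components of \<open>\<phi>\<close> act on the blocks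
  before some letter, \<open>h\<close> acts on that letter, and components of \<open>\<psi>\<close> act on the blocks after it.
  So on words of length \<open>n\<close> the map \<open>\<eta>\<close> involves \<open>\<psi>\<close> only on shorter words. The equation
  \<open>\<psi> - \<phi> = \<delta> \<eta> + \<eta> \<delta>\<close>, projected to the cogenerators, can therefore be read as a recursive
  definition of the components of \<open>\<psi>\<close> (\<open>\<psi>_component\<close>); on words of length one it gives \<open>g\<close>.

  That the equation then holds before projecting (\<open>defect_gen\<close>) is shown by induction on the length,
  using that an element of the tensor coalgebra vanishes as soon as its coproduct and its projection
  to the cogenerators do (\<open>tc_rel_if_deconc_proj\<close>). The coproduct of
  \<open>\<psi> - \<phi> - \<delta> \<eta> - \<eta> \<delta>\<close> consists of terms that contain this same difference on shorter words, of
  terms that vanish because \<open>\<phi>\<close> commutes with \<open>\<delta>\<close>, and of a term \<open>\<eta> \<otimes> (\<delta> \<psi> - \<psi> \<delta>)\<close> with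
  second factor on a shorter word. The last vanishes because \<open>\<delta>\<^sup>2 = 0\<close> turns the equation on shorter
  words into \<open>\<delta> \<psi> = \<psi> \<delta>\<close> there; this needs that \<open>\<delta>\<close> does not lengthen words
  (\<open>coderivation_length_filtration\<close>). The equation for all lengths gives \<open>\<delta> \<psi> = \<psi> \<delta>\<close> everywhere, so
  the components of \<open>\<psi>\<close> form an \<open>A\<^sub>\<infinity>\<close>-morphism.

  The same vanishing criterion shows that \<open>\<psi>\<close> and \<open>\<eta>\<close>, which are given by formulas on words, respect
  the multilinear relations (\<open>word_relations_preserved\<close>), and that coderivations and morphisms are
  determined by their components (\<open>coderivation_unique\<close>, \<open>morphism_cofree\<close>).

  Signs are carried by the operator \<open>S x = (-1)\<^bsup>|x|\<^esup> x\<close> (\<open>sign_map\<close>). A map of degree \<open>d\<close> commutes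
  with \<open>S\<close> up to \<open>(-1)\<^sup>d\<close> (\<open>tc_map_sign\<close>), so the computation does not need homogeneous
  elements.
\<close>

section \<open>Linear maps out of free modules\<close>

abbreviation free_linear :: "(('x \<Rightarrow>\<^sub>0 'r::comm_ring_1) \<Rightarrow> ('y \<Rightarrow>\<^sub>0 'r)) \<Rightarrow> bool" where
  "free_linear \<equiv> module_hom fscale fscale"

lemma module_hom_comp:
  "module_hom s1 s2 f \<Longrightarrow> module_hom s2 s3 g \<Longrightarrow> module_hom s1 s3 (\<lambda>x. g (f x))"
  by (simp add: module_hom_iff)

lemma module_hom_plus:
  "module_hom s1 s2 f \<Longrightarrow> module_hom s1 s2 g \<Longrightarrow> module_hom s1 s2 (\<lambda>x. f x + g x)"
  by (simp add: module_hom_iff module.scale_right_distrib algebra_simps)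

lemma module_hom_minus:
  "module_hom s1 s2 f \<Longrightarrow> module_hom s1 s2 g \<Longrightarrow> module_hom s1 s2 (\<lambda>x. f x - g x)"
  by (simp add: module_hom_iff module.scale_right_diff_distrib)

lemma module_hom_negate:
  "module_hom s1 s2 f \<Longrightarrow> module_hom s1 s2 (\<lambda>x. - f x)"
  by (simp add: module_hom_iff module.scale_minus_right)

lemma module_hom_const_zero: "module s1 \<Longrightarrow> module s2 \<Longrightarrow> module_hom s1 s2 (\<lambda>x. 0)"
  by (simp add: module_hom_iff module.scale_zero_right)

lemma module_hom_identity: "module s \<Longrightarrow> module_hom s s (\<lambda>x. x)"
  by (simp add: module_hom_iff)

lemma module_fscale: "module fscale"
  by (rule free.module_axioms)

lemma lin_ext_superset:
  assumes "module s" "finite K" "Poly_Mapping.keys p \<subseteq> K"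
  shows "lin_ext s g p = (\<Sum>w\<in>K. s (Poly_Mapping.lookup p w) (g w))"
  unfolding lin_ext_def using assms
  by (intro sum.mono_neutral_left) (auto simp: in_keys_iff module.scale_zero_left)

lemma lin_ext_linear:
  fixes s :: "'r::comm_ring_1 \<Rightarrow> 'b::ab_group_add \<Rightarrow> 'b"
  assumes "module s"
  shows "module_hom fscale s (lin_ext s g)"
proof -
  interpret module s by fact
  have add: "lin_ext s g (p + q) = lin_ext s g p + lin_ext s g q" for p q
  proof -
    let ?K = "Poly_Mapping.keys p \<union> Poly_Mapping.keys q"
    have "lin_ext s g (p + q) = (\<Sum>w\<in>?K. s (Poly_Mapping.lookup (p + q) w) (g w))"
      by (rule lin_ext_superset[OF assms]) (use Poly_Mapping.keys_add[of p q] in auto)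
    also have "\<dots> = lin_ext s g p + lin_ext s g q"
      by (simp add: lin_ext_superset[OF assms, of ?K] lookup_add scale_left_distrib sum.distrib)
    finally show ?thesis .
  qed
  have scale: "lin_ext s g (fscale c p) = s c (lin_ext s g p)" for c p
  proof -
    have "Poly_Mapping.keys (fscale c p) \<subseteq> Poly_Mapping.keys p"
      by (auto simp: in_keys_iff lookup_fscale)
    then have "lin_ext s g (fscale c p)
        = (\<Sum>w\<in>Poly_Mapping.keys p. s (Poly_Mapping.lookup (fscale c p) w) (g w))"
      by (intro lin_ext_superset[OF assms]) auto
    then show ?thesis
      by (simp add: lin_ext_def lookup_fscale scale_sum_right)
  qed
  show ?thesis
    by (simp add: module_hom_iff add scale assms module_fscale)
qed

lemma lin_ext_gen:
  fixes s :: "'r::comm_ring_1 \<Rightarrow> 'b::ab_group_add \<Rightarrow> 'b"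
  assumes "module s"
  shows "lin_ext s g (gen w) = g w"
proof -
  interpret module s by fact
  show ?thesis
    using lin_ext_superset[OF assms, of "{w}" "gen w" g] by (simp add: lookup_single)
qed

lemma free_lin_ext_gen [simp]: "lin_ext fscale g (gen w) = g w"
  by (rule lin_ext_gen[OF module_fscale])

lemma free_lin_ext_linear: "free_linear (lin_ext fscale g)"
  by (rule lin_ext_linear[OF module_fscale])

lemma free_induct [case_names zero monomial add]:
  fixes x :: "'x \<Rightarrow>\<^sub>0 'r::comm_ring_1"
  assumes "P 0" "\<And>c w. P (fscale c (gen w))" "\<And>x y. P x \<Longrightarrow> P y \<Longrightarrow> P (x + y)"
  shows "P x"
proof -
  have "P (\<Sum>w\<in>K. fscale (Poly_Mapping.lookup x w) (gen w))" if "finite K" for K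
    using that by induction (auto intro: assms)
  moreover have "(\<Sum>w\<in>Poly_Mapping.keys x. fscale (Poly_Mapping.lookup x w) (gen w)) = x"
    by (rule poly_mapping_eqI)
       (auto simp: lookup_sum lookup_fscale lookup_single when_def in_keys_iff if_distrib
         sum.delta cong: if_cong)
  ultimately show ?thesis by (metis finite_keys)
qed

lemma subspace_contains_all:
  assumes "free.subspace P" "\<And>w. gen w \<in> P"
  shows "x \<in> P"
  by (induction x rule: free_induct)
     (auto intro: assms free.subspace_0 free.subspace_add free.subspace_scale)

lemma free_linear_mem:
  assumes "free_linear f" "free.subspace N" "\<And>w. f (gen w) \<in> N"
  shows "f x \<in> N"
proof -
  have "x \<in> {x. f x \<in> N}"
    by (rule subspace_contains_all)
       (use assms in \<open>auto intro: module_hom.subspace_linear_preimage\<close>)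
  then show ?thesis by simp
qed

lemma free_linear_span_mem:
  assumes "free_linear f" "free.subspace N" "\<And>x. x \<in> X \<Longrightarrow> f x \<in> N" "x \<in> free.span X"
  shows "f x \<in> N"
proof -
  have "x \<in> {x. f x \<in> N}"
    using free.span_minimal[of X "{x. f x \<in> N}"] assms
      module_hom.subspace_linear_preimage[OF assms(1,2)] by blast
  then show ?thesis by simp
qed

lemma module_hom_zero_on_span:
  assumes "module_hom s t f" "\<And>x. x \<in> X \<Longrightarrow> f x = 0" "x \<in> module.span s X"
  shows "f x = 0"
  using module_hom.eq_0_on_span[OF assms(1)] assms(2,3) by blast

lemma hom_eq_on_gens:
  assumes "module_hom fscale s f" "module_hom fscale s g" "\<And>w. f (gen w) = g (gen w)"
  shows "f x = g x"
proof -
  have "x \<in> {x. f x - g x = 0}"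
    by (rule subspace_contains_all)
      (use assms in \<open>auto intro: module_hom.subspace_kernel module_hom_minus simp del: right_minus_eq\<close>)
  then show ?thesis by simp
qed

lemmas [simp] = module_fscale

subsection \<open>Tensor products of elements and of maps\<close>

lemma tens_gen [simp]: "tens (gen u) (gen v) = gen (u, v)"
  by (simp add: tens_def)

lemma tens_linear_left: "free_linear (\<lambda>x. tens x y)"
  unfolding tens_def by (rule free_lin_ext_linear)

lemma tens_gen_left: "tens (gen u) y = lin_ext fscale (\<lambda>v. gen (u, v)) y"
  by (simp add: tens_def)

lemma tens_linear_right:
  fixes x :: "'x \<Rightarrow>\<^sub>0 'r::comm_ring_1"
  shows "free_linear (tens x :: ('y \<Rightarrow>\<^sub>0 'r) \<Rightarrow> _)"
proof -
  note L = free_lin_ext_linear[THEN module_hom.add] free_lin_ext_linear[THEN module_hom.scale]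
  have "tens x (y + z) = tens x y + tens x z" for y z :: "'y \<Rightarrow>\<^sub>0 'r"
    by (rule hom_eq_on_gens[OF tens_linear_left module_hom_plus[OF tens_linear_left tens_linear_left]])
       (simp add: tens_gen_left L)
  moreover have "tens x (fscale c y) = fscale c (tens x y)" for c and y :: "'y \<Rightarrow>\<^sub>0 'r"
    by (rule hom_eq_on_gens[OF tens_linear_left
          module_hom_comp[OF tens_linear_left free.module_hom_scale_self]])
       (simp add: tens_gen_left L)
  ultimately show ?thesis by (simp add: module_hom_iff)
qed

lemmas tens_simps =
  tens_linear_left[THEN module_hom.add] tens_linear_right[THEN module_hom.add]
  tens_linear_left[THEN module_hom.diff] tens_linear_right[THEN module_hom.diff]
  tens_linear_left[THEN module_hom.neg] tens_linear_right[THEN module_hom.neg]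
  tens_linear_left[THEN module_hom.zero] tens_linear_right[THEN module_hom.zero]

text \<open>The tensor product of two maps without Koszul sign; a sign, where there is one, is put into the
  first map by composing it with \<open>sign_map\<close>.\<close>

definition tensor_map ::
  "(('x \<Rightarrow>\<^sub>0 'r::comm_ring_1) \<Rightarrow> ('y \<Rightarrow>\<^sub>0 'r)) \<Rightarrow> (('z \<Rightarrow>\<^sub>0 'r) \<Rightarrow> ('w \<Rightarrow>\<^sub>0 'r)) \<Rightarrow>
   ('x \<times> 'z \<Rightarrow>\<^sub>0 'r) \<Rightarrow> ('y \<times> 'w \<Rightarrow>\<^sub>0 'r)" where
  "tensor_map p q = lin_ext fscale (\<lambda>(u, v). tens (p (gen u)) (q (gen v)))"

lemma tensor_map_linear: "free_linear (tensor_map p q)"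
  unfolding tensor_map_def by (rule free_lin_ext_linear)

lemma tensor_map_gen [simp]: "tensor_map p q (gen (u, v)) = tens (p (gen u)) (q (gen v))"
  by (simp add: tensor_map_def)

lemma tensor_map_tens:
  assumes "free_linear p" "free_linear q"
  shows "tensor_map p q (tens x y) = tens (p x) (q y)"
proof -
  have "tensor_map p q (tens (gen u) y) = tens (p (gen u)) (q y)" for u
    by (rule hom_eq_on_gens[OF module_hom_comp[OF tens_linear_right tensor_map_linear]
          module_hom_comp[OF assms(2) tens_linear_right]]) simp
  then show ?thesis
    by (rule hom_eq_on_gens[OF module_hom_comp[OF tens_linear_left tensor_map_linear]
          module_hom_comp[OF assms(1) tens_linear_left]])
qed

section \<open>Relations of the tensor coalgebra\<close>

lemma subspace_tc_rel [simp]: "free.subspace (tc_rel s)"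
  unfolding tc_rel_def by (rule free.subspace_span)

lemma subspace_tc2_rel [simp]: "free.subspace (tc2_rel s)"
  unfolding tc2_rel_def by (rule free.subspace_span)

lemma gen_Nil_tc_rel [simp]: "gen [] \<in> tc_rel s"
  unfolding tc_rel_def by (rule free.span_base) blast

text \<open>The multilinear relations are sorted by the length of the words involved, because properties of
  relations are proved below by induction on that length.\<close>

definition word_relations ::
  "('r::comm_ring_1 \<Rightarrow> 'a::ab_group_add \<Rightarrow> 'a) \<Rightarrow> nat \<Rightarrow> ('a list \<Rightarrow>\<^sub>0 'r) set" where
  "word_relations s n =
     {gen (xs @ [x + y] @ ys) - gen (xs @ [x] @ ys) - gen (xs @ [y] @ ys) | xs x y ys.
        length xs + 1 + length ys = n}
     \<union> {gen (xs @ [s c x] @ ys) - fscale c (gen (xs @ [x] @ ys)) | xs c x ys.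
        length xs + 1 + length ys = n}"

lemma tc_rel_word_relations:
  "tc_rel s = free.span (insert (gen []) (\<Union>n. word_relations s n))"
proof -
  have "(\<Union>n. word_relations s n) =
      {gen (xs @ [x + y] @ ys) - gen (xs @ [x] @ ys) - gen (xs @ [y] @ ys) | xs x y ys. True}
      \<union> {gen (xs @ [s c x] @ ys) - fscale c (gen (xs @ [x] @ ys)) | xs c x ys. True}"
    unfolding word_relations_def UN_Un_distrib
    by (rule arg_cong2[of _ _ _ _ "(\<union>)"]; rule set_eqI; simp only: UN_iff mem_Collect_eq; metis UNIV_I)
  then show ?thesis
    unfolding tc_rel_def by (simp add: Un_assoc)
qed

lemma word_relations_subset: "word_relations s n \<subseteq> tc_rel s"
  unfolding tc_rel_word_relations by (auto intro: free.span_base)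

lemma free_linear_tc_rel:
  assumes "free_linear \<theta>" "free.subspace N" "\<theta> (gen []) \<in> N"
    "\<And>n r. r \<in> word_relations s n \<Longrightarrow> \<theta> r \<in> N" "x \<in> tc_rel s"
  shows "\<theta> x \<in> N"
  using assms(5) unfolding tc_rel_word_relations
  by (rule free_linear_span_mem[OF assms(1,2), rotated]) (use assms in auto)

lemma tens_tc2_left: "r \<in> tc_rel s \<Longrightarrow> tens r x \<in> tc2_rel s"
  unfolding tc2_rel_def by (rule free.span_base) blast

lemma tens_tc2_right: "r \<in> tc_rel s \<Longrightarrow> tens x r \<in> tc2_rel s"
  unfolding tc2_rel_def by (rule free.span_base) blast

lemma tensor_map_tc2_rel:
  assumes "free_linear p" "free_linear q" "p ` tc_rel sA \<subseteq> tc_rel sB" "q ` tc_rel sA \<subseteq> tc_rel sB"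
    "x \<in> tc2_rel sA"
  shows "tensor_map p q x \<in> tc2_rel sB"
  using assms(5) unfolding tc2_rel_def[of sA]
  by (rule free_linear_span_mem[OF tensor_map_linear subspace_tc2_rel, rotated])
     (use assms in \<open>force simp: tensor_map_tens intro: tens_tc2_left tens_tc2_right\<close>)

lemma tc_rel_add_letter:
  "gen (xs @ [x + y] @ ys) - gen (xs @ [x] @ ys) - gen (xs @ [y] @ ys) \<in> tc_rel s"
  unfolding tc_rel_def by (rule free.span_base) blast

lemma tc_rel_scale_letter:
  "gen (xs @ [s c x] @ ys) - fscale c (gen (xs @ [x] @ ys)) \<in> tc_rel s"
  unfolding tc_rel_def by (rule free.span_base) blast

lemmas tc_rel_single_letter =
  tc_rel_add_letter[of "[]" _ _ "[]", simplified] tc_rel_scale_letter[of "[]" _ _ _ "[]", simplified]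

lemma gen_zero_letter: "gen (xs @ [0] @ ys) \<in> tc_rel s"
proof -
  have "- gen (xs @ [0] @ ys) \<in> tc_rel s"
    using tc_rel_add_letter[of xs 0 0 ys s] by simp
  then show ?thesis using free.subspace_neg[OF subspace_tc_rel] by fastforce
qed

lemma deconc_linear: "free_linear deconc"
  unfolding deconc_def by (rule free_lin_ext_linear)

lemma deconc_gen: "deconc (gen w) = (\<Sum>i = 1..<length w. tens (gen (take i w)) (gen (drop i w)))"
  by (simp add: deconc_def)

text \<open>On words of length at least two, cutting off the first letter is undone by concatenation;
  the condition on the second word makes concatenation compatible with killing the empty word.\<close>

definition reattach :: "('a list \<times> 'a list \<Rightarrow>\<^sub>0 'r::comm_ring_1) \<Rightarrow> ('a list \<Rightarrow>\<^sub>0 'r)" where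
  "reattach = lin_ext fscale (\<lambda>(u, v). if length u = 1 \<and> v \<noteq> [] then gen (u @ v) else 0)"

lemma reattach_linear: "free_linear reattach"
  unfolding reattach_def by (rule free_lin_ext_linear)

lemma reattach_gen [simp]:
  "reattach (gen (u, v)) = (if length u = 1 \<and> v \<noteq> [] then gen (u @ v) else 0)"
  by (simp add: reattach_def)

text \<open>If the left factor of length one varies in a relation, its only letter does, and the
  concatenated words satisfy the relation for that letter. Longer relations are sent to zero.\<close>

lemma reattach_tens_rel_left:
  fixes s :: "'r::comm_ring_1 \<Rightarrow> 'a::ab_group_add \<Rightarrow> 'a"
  assumes "r \<in> tc_rel s"
  shows "reattach (tens r x) \<in> tc_rel s"
proof (rule free_linear_mem[OF module_hom_comp[OF tens_linear_right reattach_linear]])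
  fix v
  show "reattach (tens r (gen v)) \<in> tc_rel s"
  proof (rule free_linear_tc_rel[OF module_hom_comp[OF tens_linear_left reattach_linear] _ _ _ assms])
    fix n and r :: "'a list \<Rightarrow>\<^sub>0 'r" assume r: "r \<in> word_relations s n"
    have R: "reattach (tens (gen us) (gen v)) = (if n = 1 \<and> v \<noteq> [] then gen (us @ v) else 0)"
      if "length us = n" for us :: "'a list"
      using that by simp
    note Q = tc_rel_add_letter[of "[]" _ _ v s] tc_rel_scale_letter[of "[]" s _ _ v]
    show "reattach (tens r (gen v)) \<in> tc_rel s"
      using r Q unfolding word_relations_def
      by (auto simp: tens_simps R tens_linear_left[THEN module_hom.scale]
          reattach_linear[THEN module_hom.diff] reattach_linear[THEN module_hom.scale] free.subspace_0)
  qed (simp_all add: free.subspace_0)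
qed simp

lemma reattach_tens_rel_right:
  fixes s :: "'r::comm_ring_1 \<Rightarrow> 'a::ab_group_add \<Rightarrow> 'a"
  assumes "r \<in> tc_rel s"
  shows "reattach (tens x r) \<in> tc_rel s"
proof (rule free_linear_mem[OF module_hom_comp[OF tens_linear_left reattach_linear]])
  fix u :: "'a list"
  show "reattach (tens (gen u) r) \<in> tc_rel s"
  proof (rule free_linear_tc_rel[OF module_hom_comp[OF tens_linear_right reattach_linear] _ _ _ assms])
    fix n and r :: "'a list \<Rightarrow>\<^sub>0 'r" assume r: "r \<in> word_relations s n"
    note Q = tc_rel_add_letter[of "u @ xs" _ _ ys s for xs ys]
      tc_rel_scale_letter[of "u @ xs" s _ _ ys for xs ys]
    show "reattach (tens (gen u) r) \<in> tc_rel s"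
      using r Q unfolding word_relations_def
      by (auto simp: tens_simps tens_linear_right[THEN module_hom.scale]
          reattach_linear[THEN module_hom.diff] reattach_linear[THEN module_hom.scale] free.subspace_0)
  qed (simp_all add: free.subspace_0)
qed simp

lemma reattach_tc2_rel: "x \<in> tc2_rel s \<Longrightarrow> reattach x \<in> tc_rel s"
  unfolding tc2_rel_def
  by (rule free_linear_span_mem[OF reattach_linear subspace_tc_rel, rotated])
     (auto intro: reattach_tens_rel_left reattach_tens_rel_right)

lemma reattach_deconc_gen: "reattach (deconc (gen w)) = (if length w \<ge> 2 then gen w else 0)"
proof -
  have "reattach (deconc (gen w)) = (\<Sum>i = 1..<length w. if i = 1 then gen w else 0)"
    unfolding deconc_gen reattach_linear[THEN module_hom.sum]
    by (rule sum.cong) (auto simp: min_def)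
  then show ?thesis by (simp add: sum.delta Suc_le_eq numeral_2_eq_2)
qed

lemma tc_proj_linear: "module s \<Longrightarrow> module_hom fscale s (tc_proj s)"
  unfolding tc_proj_def by (rule lin_ext_linear)

lemma tc_proj_gen: "module s \<Longrightarrow> tc_proj s (gen w) = (if length w = 1 then hd w else 0)"
  unfolding tc_proj_def by (simp add: lin_ext_gen)

lemma tc_proj_tc_rel:
  assumes "module s" "x \<in> tc_rel s" shows "tc_proj s x = 0"
proof (rule module_hom_zero_on_span[OF tc_proj_linear[OF assms(1)] _ assms(2)[unfolded tc_rel_word_relations]])
  fix r assume "r \<in> insert (gen []) (\<Union>n. word_relations s n)"
  then show "tc_proj s r = 0"
    using tc_proj_linear[OF assms(1), THEN module_hom.diff]
      tc_proj_linear[OF assms(1), THEN module_hom.scale] assms(1)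
    by (auto simp: word_relations_def tc_proj_gen module.scale_zero_right Cons_eq_append_conv split: if_splits)
qed

text \<open>Words of length at least two are recovered from their coproduct by \<open>reattach\<close>, and sums of words of
  length one are, up to relations, the single letter to which \<open>tc_proj\<close> adds them up.\<close>

lemma tc_decompose:
  assumes "module s"
  shows "x - reattach (deconc x) - gen [tc_proj s x] \<in> tc_rel s" (is "?d x \<in> _")
proof (induction x rule: free_induct)
  case zero
  show ?case
    using free.subspace_neg[OF subspace_tc_rel gen_zero_letter[of "[]" "[]" s]]
    by (simp add: tc_proj_linear[OF assms, THEN module_hom.zero] deconc_linear[THEN module_hom.zero]
        reattach_linear[THEN module_hom.zero])
next
  case (monomial c w)
  interpret module s by fact
  note P = tc_proj_linear[OF assms, THEN module_hom.scale]
  have "?d (fscale c (gen w)) \<in> tc_rel s"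
  proof -
    have "w = [] \<or> length w = 1 \<or> length w \<ge> 2" by (cases w) (auto simp: Suc_le_eq)
    then show ?thesis
    proof (elim disjE)
      assume "w = []"
      then show ?thesis using gen_zero_letter[of "[]" "[]" s]
        by (auto simp: P tc_proj_gen assms deconc_linear[THEN module_hom.scale] deconc_gen
            reattach_linear[THEN module_hom.zero]
            intro!: free.subspace_diff free.subspace_scale)
    next
      assume "length w = 1"
      then obtain a where "w = [a]" by (cases w) auto
      then show ?thesis
        using free.subspace_neg[OF subspace_tc_rel tc_rel_single_letter(2)[of s c a]]
        by (simp add: P tc_proj_gen assms deconc_linear[THEN module_hom.scale] deconc_gen
            reattach_linear[THEN module_hom.zero])
    next
      assume "length w \<ge> 2"
      then show ?thesis
        using free.subspace_neg[OF subspace_tc_rel gen_zero_letter[of "[]" "[]" s]]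
        by (simp add: P tc_proj_gen assms deconc_linear[THEN module_hom.scale]
            reattach_linear[THEN module_hom.scale] reattach_deconc_gen)
    qed
  qed
  then show ?case by simp
next
  case (add p q)
  have "?d (p + q) = ?d p + ?d q - (gen [tc_proj s p + tc_proj s q] - gen [tc_proj s p] - gen [tc_proj s q])"
    by (simp add: tc_proj_linear[OF assms, THEN module_hom.add] deconc_linear[THEN module_hom.add]
      reattach_linear[THEN module_hom.add] algebra_simps)
  moreover have "\<dots> \<in> tc_rel s"
    by (rule free.subspace_diff[OF subspace_tc_rel free.subspace_add[OF subspace_tc_rel add]
        tc_rel_single_letter(1)])
  ultimately show ?case by (simp only:)
qed

text \<open>The primitive elements of the tensor coalgebra are the cogenerators. All uniqueness
  arguments in the sequel rest on this criterion.\<close>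

lemma tc_rel_if_deconc_proj:
  assumes "module s" "deconc x \<in> tc2_rel s" "tc_proj s x = 0"
  shows "x \<in> tc_rel s"
proof -
  have "x - reattach (deconc x) - gen [0] \<in> tc_rel s"
    using tc_decompose[OF assms(1), of x] assms(3) by simp
  moreover have "reattach (deconc x) \<in> tc_rel s"
    by (rule reattach_tc2_rel) fact
  moreover have "gen [0] \<in> tc_rel s" using gen_zero_letter[of "[]" "[]" s] by simp
  ultimately have "(x - reattach (deconc x) - gen [0]) + reattach (deconc x) + gen [0] \<in> tc_rel s"
    by (intro free.subspace_add[OF subspace_tc_rel])
  then show ?thesis by simp
qed

section \<open>Signs and degrees\<close>

definition signed :: "int \<Rightarrow> 'x::ab_group_add \<Rightarrow> 'x" where
  "signed n x = (if even n then x else - x)"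

lemma signed_add: "signed (m + n) x = signed m (signed n x)"
  by (auto simp: signed_def)

lemma signed_involutive [simp]: "signed n (signed n x) = x"
  by (simp add: signed_def)

lemma signed_zero [simp]: "signed 0 x = x"
  by (simp add: signed_def)

lemma module_hom_signed: "module_hom s t f \<Longrightarrow> f (signed n x) = signed n (f x)"
  by (simp add: signed_def module_hom.neg)

lemma signed_linear:
  "module_hom s t f \<Longrightarrow> module_hom s t (\<lambda>x. signed n (f x))"
  by (cases "even n") (simp_all add: signed_def module_hom_negate)

lemma signed_mem: "module s \<Longrightarrow> module.subspace s P \<Longrightarrow> x \<in> P \<Longrightarrow> signed n x \<in> P"
  by (simp add: signed_def module.subspace_neg)

lemma signed_mem_free: "free.subspace P \<Longrightarrow> x \<in> P \<Longrightarrow> signed n x \<in> P"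
  by (rule signed_mem[OF module_fscale])

lemma signed_diff: "signed n (x - y) = signed n x - signed n y"
  by (simp add: signed_def)

context graded_module
begin

lemma parity_decomposes:
  assumes "decomposes A x c" "finite N" "{n. c n \<noteq> 0} \<subseteq> N"
  shows "parity A x = (\<Sum>n\<in>N. signed n (c n))"
proof -
  have c: "(THE c. decomposes A x c) = c"
    by (rule the_equality) (use direct_sum[of x] assms(1) in blast)+
  show ?thesis
    unfolding parity_def Let_def signed_def c
    by (rule sum.mono_neutral_left) (use assms in auto)
qed

lemma decomposes_sum:
  assumes "decomposes A x c" "finite N" "{n. c n \<noteq> 0} \<subseteq> N"
  shows "x = (\<Sum>n\<in>N. c n)"
proof -
  have "(\<Sum>n | c n \<noteq> 0. c n) = (\<Sum>n\<in>N. c n)"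
    by (rule sum.mono_neutral_left) (use assms in auto)
  then show ?thesis using assms(1) by (simp add: decomposes_def)
qed

lemma decomposesI:
  assumes "finite N" "{n. c n \<noteq> 0} \<subseteq> N" "\<And>n. c n \<in> A n" "x = (\<Sum>n\<in>N. c n)"
  shows "decomposes A x c"
proof -
  have "(\<Sum>n | c n \<noteq> 0. c n) = (\<Sum>n\<in>N. c n)"
    by (rule sum.mono_neutral_left) (use assms in auto)
  then show ?thesis
    using assms finite_subset by (auto simp: decomposes_def)
qed

lemma parity_homogeneous:
  assumes "x \<in> A n" shows "parity A x = signed n x"
proof -
  have "decomposes A x (\<lambda>m. if m = n then x else 0)"
    by (rule decomposesI[of "{n}"]) (use assms homogeneous_subspace subspace_0 in auto)
  moreover have "{m. (if m = n then x else 0) \<noteq> 0} \<subseteq> {n}" by auto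
  ultimately show ?thesis using parity_decomposes[of x _ "{n}"] by fastforce
qed

lemma parity_linear: "module_hom s s (parity A)"
proof -
  have add: "parity A (x + y) = parity A x + parity A y" for x y
  proof -
    obtain c d where c: "decomposes A x c" and d: "decomposes A y d"
      using direct_sum by blast
    let ?N = "{n. c n \<noteq> 0} \<union> {n. d n \<noteq> 0}"
    have N: "finite ?N" "{n. c n \<noteq> 0} \<subseteq> ?N" "{n. d n \<noteq> 0} \<subseteq> ?N"
      using c d by (auto simp: decomposes_def)
    have "x + y = (\<Sum>n\<in>?N. c n + d n)"
      using decomposes_sum[OF c N(1,2)] decomposes_sum[OF d N(1,3)] by (simp add: sum.distrib)
    then have "decomposes A (x + y) (\<lambda>n. c n + d n)"
      by (intro decomposesI[OF N(1)])
        (use c d subspace_add[OF homogeneous_subspace] in \<open>auto simp: decomposes_def\<close>)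
    moreover have "{n. c n + d n \<noteq> 0} \<subseteq> ?N" by auto
    ultimately have "parity A (x + y) = (\<Sum>n\<in>?N. signed n (c n + d n))"
      by (rule parity_decomposes[OF _ N(1)])
    also have "\<dots> = (\<Sum>n\<in>?N. signed n (c n) + signed n (d n))"
      by (rule sum.cong) (simp_all add: signed_def)
    finally show ?thesis
      unfolding parity_decomposes[OF c N(1,2)] parity_decomposes[OF d N(1,3)] sum.distrib .
  qed
  have scale: "parity A (s a x) = s a (parity A x)" for a x
  proof -
    obtain c where c: "decomposes A x c" using direct_sum by blast
    let ?N = "{n. c n \<noteq> 0}"
    have N: "finite ?N" using c by (auto simp: decomposes_def)
    have "s a x = (\<Sum>n\<in>?N. s a (c n))"
      using decomposes_sum[OF c N subset_refl] by (metis scale_sum_right)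
    then have "decomposes A (s a x) (\<lambda>n. s a (c n))"
      by (intro decomposesI[OF N])
        (use c subspace_scale[OF homogeneous_subspace] in \<open>auto simp: decomposes_def\<close>)
    moreover have "{n. s a (c n) \<noteq> 0} \<subseteq> ?N" by auto
    ultimately have "parity A (s a x) = (\<Sum>n\<in>?N. signed n (s a (c n)))"
      by (rule parity_decomposes[OF _ N])
    also have "\<dots> = (\<Sum>n\<in>?N. s a (signed n (c n)))"
      by (rule sum.cong) (simp_all add: signed_def)
    finally show ?thesis
      unfolding parity_decomposes[OF c N subset_refl] scale_sum_right .
  qed
  show ?thesis by (simp add: module_hom_iff add scale module_axioms)
qed

text \<open>In this form the direct sum decomposition is used to check linear statements on homogeneous
  elements only.\<close>

lemma homogeneous_parts_span:
  assumes "subspace P" "\<And>n x. x \<in> A n \<Longrightarrow> x \<in> P"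
  shows "x \<in> P"
proof -
  obtain c where c: "decomposes A x c" using direct_sum by blast
  then have "x = (\<Sum>n | c n \<noteq> 0. c n)" "\<And>n. c n \<in> A n" by (auto simp: decomposes_def)
  then show ?thesis using subspace_sum[OF assms(1)] assms(2) by metis
qed

lemma parity_involutive [simp]: "parity A (parity A x) = x"
proof -
  have "x \<in> {x. parity A (parity A x) - x = 0}"
  proof (rule homogeneous_parts_span)
    show "subspace {x. parity A (parity A x) - x = 0}"
      by (rule module_hom.subspace_kernel[OF module_hom_minus[OF
            module_hom_comp[OF parity_linear parity_linear] module_hom_identity[OF module_axioms]]])
    fix n x assume "x \<in> A n"
    then show "x \<in> {x. parity A (parity A x) - x = 0}"
      by (simp add: parity_homogeneous module_hom_signed[OF parity_linear])
  qed
  then show ?thesis by simp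
qed

end

text \<open>The operator \<open>x \<mapsto> (-1)\<^bsup>|x|\<^esup> x\<close> of the tensor coalgebra.\<close>

definition sign_map :: "(int \<Rightarrow> 'a::ab_group_add set) \<Rightarrow> ('a list \<Rightarrow>\<^sub>0 'r::comm_ring_1) \<Rightarrow> ('a list \<Rightarrow>\<^sub>0 'r)" where
  "sign_map A = lin_ext fscale (\<lambda>w. gen (map (\<lambda>a. - parity A a) w))"

lemma sign_map_linear: "free_linear (sign_map A)"
  unfolding sign_map_def by (rule free_lin_ext_linear)

lemma sign_map_gen [simp]: "sign_map A (gen w) = gen (map (\<lambda>a. - parity A a) w)"
  by (simp add: sign_map_def)

lemma tmap_tensor_map:
  "tmap A d p q = tensor_map (if even d then p else (\<lambda>x. p (sign_map A x))) q"
  unfolding tmap_def tensor_map_def by (auto simp: fun_eq_iff intro!: arg_cong2[of _ _ _ _ "lin_ext fscale"])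

lemma gen_signed_letter:
  assumes "module s"
  shows "gen (xs @ [signed n x] @ ys) - signed n (gen (xs @ [x] @ ys)) \<in> tc_rel s"
proof (cases "even n")
  case False
  have "gen (xs @ [s (- 1) x] @ ys) - fscale (- 1) (gen (xs @ [x] @ ys)) \<in> tc_rel s"
    by (rule tc_rel_scale_letter)
  then show ?thesis
    using False by (simp add: signed_def free.scale_minus_left module.scale_minus_left[OF assms] module.scale_one[OF assms])
qed (simp add: signed_def free.subspace_0)

lemma gen_signed_letters:
  assumes "module s" "length ns = length ws"
  shows "gen (map2 signed ns ws) - signed (sum_list ns) (gen ws) \<in> tc_rel s"
proof -
  have "gen (p @ map2 signed ns ws) - signed (sum_list ns) (gen (p @ ws)) \<in> tc_rel s" for p
    using assms(2)
  proof (induction ns ws arbitrary: p rule: list_induct2)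
    case (Cons n ns w ws)
    have "gen ((p @ [signed n w]) @ map2 signed ns ws) - signed (sum_list ns) (gen ((p @ [signed n w]) @ ws)) \<in> tc_rel s"
      by (rule Cons.IH)
    moreover have "signed (sum_list ns) (gen (p @ [signed n w] @ ws) - signed n (gen (p @ [w] @ ws))) \<in> tc_rel s"
      by (intro signed_mem_free gen_signed_letter assms(1) subspace_tc_rel)
    ultimately have "(gen ((p @ [signed n w]) @ map2 signed ns ws) - signed (sum_list ns) (gen ((p @ [signed n w]) @ ws)))
        + signed (sum_list ns) (gen (p @ [signed n w] @ ws) - signed n (gen (p @ [w] @ ws))) \<in> tc_rel s"
      by (rule free.subspace_add[OF subspace_tc_rel])
    then show ?case
      by (simp add: signed_diff signed_add[symmetric] add.commute)
  qed (simp add: free.subspace_0)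
  from this[of "[]"] show ?thesis by simp
qed

lemma sign_map_tc_rel:
  assumes "graded_module s A" "x \<in> tc_rel s"
  shows "sign_map A x \<in> tc_rel s"
proof (rule free_linear_tc_rel[OF sign_map_linear subspace_tc_rel _ _ assms(2)])
  interpret graded_module s A by fact
  note P = parity_linear[THEN module_hom.add] parity_linear[THEN module_hom.scale]
  show "sign_map A (gen []) \<in> tc_rel s" by simp
  fix n r assume "r \<in> word_relations s n"
  then show "sign_map A r \<in> tc_rel s"
  proof (unfold word_relations_def, elim UnE CollectE exE conjE)
    fix xs ys and x y :: 'b
    assume "r = gen (xs @ [x + y] @ ys) - gen (xs @ [x] @ ys) - gen (xs @ [y] @ ys)"
    then show "sign_map A r \<in> tc_rel s"
      using tc_rel_add_letter[of "map (\<lambda>a. - parity A a) xs" "- parity A x" "- parity A y" "map (\<lambda>a. - parity A a) ys" s]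
      by (simp add: sign_map_linear[THEN module_hom.diff] P)
  next
    fix xs ys c and x :: 'b
    assume "r = gen (xs @ [s c x] @ ys) - fscale c (gen (xs @ [x] @ ys))"
    then show "sign_map A r \<in> tc_rel s"
      using tc_rel_scale_letter[of "map (\<lambda>a. - parity A a) xs" s c "- parity A x" "map (\<lambda>a. - parity A a) ys"]
      by (simp add: sign_map_linear[THEN module_hom.diff] sign_map_linear[THEN module_hom.scale] P)
  qed
qed

lemma sign_map_involutive:
  assumes "graded_module s A"
  shows "sign_map A (sign_map A x) = x"
proof -
  interpret graded_module s A by fact
  show ?thesis
    by (rule hom_eq_on_gens[OF module_hom_comp[OF sign_map_linear sign_map_linear]
          module_hom_identity]) (simp_all add: o_def parity_linear[THEN module_hom.neg])
qed

lemma homogeneous_word_simps [simp]: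
  "homogeneous_word A [] []"
  "homogeneous_word A (n # ns) (x # xs) \<longleftrightarrow> x \<in> A n \<and> homogeneous_word A ns xs"
  "homogeneous_word A ns [] \<longleftrightarrow> ns = []"
  by (auto simp: homogeneous_word_def)

lemma homogeneous_word_Cons:
  "homogeneous_word A ns (x # xs) \<longleftrightarrow> (\<exists>n ms. ns = n # ms \<and> x \<in> A n \<and> homogeneous_word A ms xs)"
  by (auto simp: homogeneous_word_def list_all2_Cons2)

lemma homogeneous_word_length: "homogeneous_word A ns xs \<Longrightarrow> length ns = length xs"
  by (simp add: homogeneous_word_def list_all2_lengthD)

lemma homogeneous_word_append:
  "homogeneous_word A ns xs \<Longrightarrow> homogeneous_word A ms ys \<Longrightarrow> homogeneous_word A (ns @ ms) (xs @ ys)"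
  by (simp add: homogeneous_word_def list_all2_appendI)

lemma homogeneous_word_take: "homogeneous_word A ns xs \<Longrightarrow> homogeneous_word A (take i ns) (take i xs)"
  by (simp add: homogeneous_word_def list_all2_takeI)

lemma homogeneous_word_drop: "homogeneous_word A ns xs \<Longrightarrow> homogeneous_word A (drop i ns) (drop i xs)"
  by (simp add: homogeneous_word_def list_all2_dropI)

text \<open>A letter stands for its suspension, so it counts with one more than its degree.\<close>

definition tensor_degree :: "int list \<Rightarrow> int" where
  "tensor_degree ns = (\<Sum>n\<leftarrow>ns. n + 1)"

lemma tensor_degree_simps [simp]:
  "tensor_degree [] = 0" "tensor_degree (n # ns) = n + 1 + tensor_degree ns"
  "tensor_degree (ns @ ms) = tensor_degree ns + tensor_degree ms"
  by (simp_all add: tensor_degree_def)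

text \<open>The letters of a word are split into their homogeneous parts one after the other, from left to
  right: the word \<open>p @ w\<close> in the proof has a prefix \<open>p\<close> that is already homogeneous.\<close>

lemma homogeneous_words_span:
  assumes "graded_module s A" "free.subspace P" "tc_rel s \<subseteq> P"
    "\<And>ns w. w \<noteq> [] \<Longrightarrow> homogeneous_word A ns w \<Longrightarrow> gen w \<in> P"
  shows "x \<in> P"
proof (rule subspace_contains_all[OF assms(2)])
  interpret graded_module s A by fact
  fix w
  have "homogeneous_word A ns p \<Longrightarrow> gen (p @ w) \<in> P" for ns p
  proof (induction w arbitrary: ns p)
    case Nil
    then show ?case using assms(3,4) gen_Nil_tc_rel by (cases "p = []") auto
  next
    case (Cons x w)
    have "x \<in> {x. gen (p @ [x] @ w) \<in> P}"
    proof (rule homogeneous_parts_span)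
      have sum: "gen (p @ [x + y] @ w) \<in> P" if "gen (p @ [x] @ w) \<in> P" "gen (p @ [y] @ w) \<in> P" for x y
        using free.subspace_add[OF assms(2) free.subspace_add[OF assms(2) that]
            assms(3)[THEN subsetD, OF tc_rel_add_letter[of p x y w s]]] by simp
      have scale: "gen (p @ [s c x] @ w) \<in> P" if "gen (p @ [x] @ w) \<in> P" for c x
        using free.subspace_add[OF assms(2) free.subspace_scale[OF assms(2) that, of c]
            assms(3)[THEN subsetD, OF tc_rel_scale_letter[of p s c x w]]] by simp
      show "subspace {x. gen (p @ [x] @ w) \<in> P}"
        using sum scale gen_zero_letter[of p w s] assms(3) by (intro subspaceI) auto
      fix n x assume "x \<in> A n"
      then show "x \<in> {x. gen (p @ [x] @ w) \<in> P}"
        using Cons.IH[of "ns @ [n]" "p @ [x]"] homogeneous_word_append[OF Cons.prems, of "[n]" "[x]"] by simp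
    qed
    then show ?case by simp
  qed
  from this[of "[]" "[]"] show "gen w \<in> P" by simp
qed

definition homogeneous_span :: "(int \<Rightarrow> 'a set) \<Rightarrow> int \<Rightarrow> ('a list \<Rightarrow>\<^sub>0 'r::comm_ring_1) set" where
  "homogeneous_span A d = free.span {gen xs | xs ns. homogeneous_word A ns xs \<and> tensor_degree ns = d}"

lemma subspace_homogeneous_span [simp]: "free.subspace (homogeneous_span A d)"
  by (simp add: homogeneous_span_def)

lemma gen_homogeneous_span: "homogeneous_word A ns xs \<Longrightarrow> gen xs \<in> homogeneous_span A (tensor_degree ns)"
  unfolding homogeneous_span_def by (rule free.span_base) blast

lemma free_linear_homogeneous_span:
  assumes "free_linear \<theta>" "free.subspace N"
    "\<And>ns w. homogeneous_word A ns w \<Longrightarrow> tensor_degree ns = d \<Longrightarrow> \<theta> (gen w) \<in> N"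
    "x \<in> homogeneous_span A d"
  shows "\<theta> x \<in> N"
  using assms(4) unfolding homogeneous_span_def
  by (rule free_linear_span_mem[OF assms(1,2), rotated]) (use assms(3) in blast)

lemma tc_deg_iff: "x \<in> tc_deg s A d \<longleftrightarrow> (\<exists>y \<in> homogeneous_span A d. x - y \<in> tc_rel s)"
  by (simp add: tc_deg_def homogeneous_span_def tensor_degree_def)

lemma homogeneous_span_tc_deg: "x \<in> homogeneous_span A d \<Longrightarrow> x \<in> tc_deg s A d"
  unfolding tc_deg_iff by (rule bexI[of _ x]) (simp_all add: free.subspace_0)

lemma tc_rel_tc_deg: "x \<in> tc_rel s \<Longrightarrow> x \<in> tc_deg s A d"
  unfolding tc_deg_iff by (rule bexI[of _ 0]) (simp_all add: free.subspace_0)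

lemma subspace_tc_deg [simp]: "free.subspace (tc_deg s A d)"
proof -
  have "tc_deg s A d = {x + y |x y. x \<in> homogeneous_span A d \<and> y \<in> tc_rel s}"
    unfolding tc_deg_iff set_eq_iff by (auto simp: algebra_simps) (metis add_diff_cancel_left' add.commute diff_add_cancel)+
  also have "\<dots> = free.span (homogeneous_span A d \<union> tc_rel s)"
    unfolding free.span_Un by (simp add: free.span_eq_iff[THEN iffD2])
  finally show ?thesis by simp
qed

lemma free_linear_tc_deg:
  assumes "free_linear \<theta>" "free.subspace N" "\<And>x. x \<in> tc_rel s \<Longrightarrow> \<theta> x \<in> N"
    "\<And>ns w. homogeneous_word A ns w \<Longrightarrow> tensor_degree ns = d \<Longrightarrow> \<theta> (gen w) \<in> N"
    "x \<in> tc_deg s A d"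
  shows "\<theta> x \<in> N"
proof -
  obtain y where y: "y \<in> homogeneous_span A d" "x - y \<in> tc_rel s"
    using assms(5) tc_deg_iff by blast
  have "\<theta> (x - y) + \<theta> y \<in> N"
    by (rule free.subspace_add[OF assms(2) assms(3)[OF y(2)]
        free_linear_homogeneous_span[OF assms(1,2,4) y(1)]])
  then show ?thesis by (simp add: assms(1)[THEN module_hom.diff])
qed

lemma sign_map_tc_deg:
  assumes "graded_module s A" "x \<in> tc_deg s A d"
  shows "sign_map A x - signed d x \<in> tc_rel s"
proof (rule free_linear_tc_deg[OF _ subspace_tc_rel _ _ assms(2)])
  interpret graded_module s A by fact
  show "free_linear (\<lambda>x. sign_map A x - signed d x)"
    by (intro module_hom_minus sign_map_linear signed_linear module_hom_identity module_fscale)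
  show "sign_map A x - signed d x \<in> tc_rel s" if "x \<in> tc_rel s" for x
    using that by (intro free.subspace_diff signed_mem_free sign_map_tc_rel assms(1)) auto
  fix ns w assume w: "homogeneous_word A ns w" and d: "tensor_degree ns = d"
  then have "map (\<lambda>a. - parity A a) w = map2 signed (map (\<lambda>n. n + 1) ns) w"
  proof (induction w arbitrary: ns d)
    case (Cons a w)
    then obtain n ms where "ns = n # ms" "a \<in> A n" "homogeneous_word A ms w"
      by (auto simp: homogeneous_word_Cons)
    with Cons.IH[of ms] show ?case by (auto simp: parity_homogeneous signed_def)
  qed simp
  moreover have "sum_list (map (\<lambda>n. n + 1) ns) = d"
    using d by (simp add: tensor_degree_def)
  ultimately show "sign_map A (gen w) - signed d (gen w) \<in> tc_rel s"
    using gen_signed_letters[OF module_axioms, of "map (\<lambda>n. n + 1) ns" w] homogeneous_word_length[OF w]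
    by simp
qed

lemma tc_map_linear: "tc_map sA A sB B d \<theta> \<Longrightarrow> free_linear \<theta>"
  by (simp add: tc_map_def)

lemma tc_map_tc_rel: "tc_map sA A sB B d \<theta> \<Longrightarrow> x \<in> tc_rel sA \<Longrightarrow> \<theta> x \<in> tc_rel sB"
  unfolding tc_map_def by blast

lemma tc_map_tc_deg: "tc_map sA A sB B d \<theta> \<Longrightarrow> x \<in> tc_deg sA A n \<Longrightarrow> \<theta> x \<in> tc_deg sB B (n + d)"
  unfolding tc_map_def by blast

text \<open>On a homogeneous word of degree \<open>n\<close> the operator \<open>sign_map\<close> is \<open>(-1)\<^sup>n\<close> before and \<open>(-1)\<^bsup>n + d\<^esup>\<close> after
  applying a map of degree \<open>d\<close>.\<close>

lemma tc_map_sign: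
  assumes "graded_module sA A" "graded_module sB B" and \<theta>: "tc_map sA A sB B d \<theta>"
  shows "sign_map B (\<theta> x) - signed d (\<theta> (sign_map A x)) \<in> tc_rel sB" (is "?D x \<in> _")
proof -
  note lin = tc_map_linear[OF \<theta>]
  have D: "free_linear ?D"
    by (intro module_hom_minus signed_linear module_hom_comp[OF _ sign_map_linear] lin
        module_hom_comp[OF sign_map_linear lin])
  have "x \<in> {x. ?D x \<in> tc_rel sB}"
  proof (rule homogeneous_words_span[OF assms(1)])
    show "free.subspace {x. ?D x \<in> tc_rel sB}"
      by (rule module_hom.subspace_linear_preimage[OF D]) simp
    show "tc_rel sA \<subseteq> {x. ?D x \<in> tc_rel sB}"
      using assms by (auto intro!: free.subspace_diff signed_mem_free sign_map_tc_rel tc_map_tc_rel[OF \<theta>])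
    fix ns w assume w: "homogeneous_word A ns w"
    let ?n = "tensor_degree ns"
    have x: "gen w \<in> tc_deg sA A ?n"
      by (intro homogeneous_span_tc_deg gen_homogeneous_span w)
    have 1: "sign_map B (\<theta> (gen w)) - signed (?n + d) (\<theta> (gen w)) \<in> tc_rel sB"
      by (rule sign_map_tc_deg[OF assms(2) tc_map_tc_deg[OF \<theta> x]])
    have "signed d (\<theta> (sign_map A (gen w) - signed ?n (gen w))) \<in> tc_rel sB"
      by (intro signed_mem_free tc_map_tc_rel[OF \<theta>] sign_map_tc_deg assms x) simp_all
    from free.subspace_diff[OF subspace_tc_rel 1 this]
    show "gen w \<in> {x. ?D x \<in> tc_rel sB}"
      unfolding lin[THEN module_hom.diff] module_hom_signed[OF lin]
      by (simp add: signed_diff signed_add[symmetric] add.commute)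
  qed
  then show ?thesis by simp
qed

lemma tc_proj_tc_deg:
  assumes "graded_module s A" "x \<in> tc_deg s A d"
  shows "tc_proj s x \<in> A (d - 1)"
proof -
  interpret graded_module s A by fact
  obtain y where y: "y \<in> homogeneous_span A d" "x - y \<in> tc_rel s"
    using assms(2) tc_deg_iff by blast
  note P = tc_proj_linear[OF module_axioms]
  have "y \<in> {y. tc_proj s y \<in> A (d - 1)}"
  proof -
    have "free.subspace {y. tc_proj s y \<in> A (d - 1)}"
      using module_hom.subspace_linear_preimage[OF P homogeneous_subspace] .
    moreover have "tc_proj s (gen w) \<in> A (d - 1)" if "homogeneous_word A ns w" "tensor_degree ns = d" for ns w
      using that subspace_0[OF homogeneous_subspace]
      by (cases w) (auto simp: tc_proj_gen module_axioms homogeneous_word_Cons)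
    ultimately show ?thesis
      using y(1) unfolding homogeneous_span_def
      by (intro free.span_minimal[THEN subsetD, OF _ _ y(1)[unfolded homogeneous_span_def]]) auto
  qed
  moreover have "tc_proj s x = tc_proj s y"
    using tc_proj_tc_rel[OF module_axioms y(2)] by (simp add: P[THEN module_hom.diff])
  ultimately show ?thesis by simp
qed

text \<open>Components are prescribed on homogeneous words only, but these span modulo relations.\<close>

lemma has_components_proj_eq:
  assumes "graded_module sA A" "module sB" "tc_map sA A sB B d \<theta>" "tc_map sA A sB B d \<theta>'"
    "has_components A sB \<theta> m" "has_components A sB \<theta>' m"
  shows "tc_proj sB (\<theta> x) = tc_proj sB (\<theta>' x)"
proof -
  note lin = tc_map_linear[OF assms(3)] tc_map_linear[OF assms(4)]
  note P = tc_proj_linear[OF assms(2)]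
  have "x \<in> {x. tc_proj sB (\<theta> x) - tc_proj sB (\<theta>' x) = 0}"
  proof (rule homogeneous_words_span[OF assms(1)])
    show "free.subspace {x. tc_proj sB (\<theta> x) - tc_proj sB (\<theta>' x) = 0}"
      by (rule module_hom.subspace_kernel[OF module_hom_minus[OF
            module_hom_comp[OF lin(1) P] module_hom_comp[OF lin(2) P]]])
    show "tc_rel sA \<subseteq> {x. tc_proj sB (\<theta> x) - tc_proj sB (\<theta>' x) = 0}"
      by (auto simp: tc_proj_tc_rel[OF assms(2)] tc_map_tc_rel[OF assms(3)] tc_map_tc_rel[OF assms(4)])
    fix ns w assume "w \<noteq> []" "homogeneous_word A ns w"
    then show "gen w \<in> {x. tc_proj sB (\<theta> x) - tc_proj sB (\<theta>' x) = 0}"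
      using assms(5,6) unfolding has_components_def by simp
  qed
  then show ?thesis by simp
qed

section \<open>Coderivations\<close>

lemma coderivation_deconc:
  assumes "tc_coderivation s A \<delta>"
  shows "deconc (\<delta> x) - (tensor_map \<delta> id (deconc x) + tensor_map (sign_map A) \<delta> (deconc x)) \<in> tc2_rel s"
  using assms by (simp add: tc_coderivation_def tmap_tensor_map)

lemma tensor_map_deconc_gen:
  "tensor_map p q (deconc (gen w)) = (\<Sum>i = 1..<length w. tens (p (gen (take i w))) (q (gen (drop i w))))"
  by (simp add: deconc_gen tensor_map_linear[THEN module_hom.sum])

text \<open>The coproduct of the difference of the two coderivations on a word involves the difference on
  shorter words only, so that induction on the length applies.\<close>

lemma coderivation_unique:
  assumes "graded_module s A" "tc_coderivation s A \<delta>" "tc_coderivation s A \<delta>'"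
    "\<And>x. tc_proj s (\<delta> x) = tc_proj s (\<delta>' x)"
  shows "\<delta> x - \<delta>' x \<in> tc_rel s"
proof -
  interpret graded_module s A by fact
  note lin = assms(2,3)[unfolded tc_coderivation_def, THEN conjunct1, THEN tc_map_linear]
  show ?thesis
  proof (rule free_linear_mem[OF module_hom_minus[OF lin]])
    fix w
    show "\<delta> (gen w) - \<delta>' (gen w) \<in> tc_rel s"
    proof (induction w rule: length_induct)
      case (1 w)
      have "deconc (\<delta> (gen w) - \<delta>' (gen w)) =
         (deconc (\<delta> (gen w)) - (tensor_map \<delta> id (deconc (gen w)) + tensor_map (sign_map A) \<delta> (deconc (gen w))))
         - (deconc (\<delta>' (gen w)) - (tensor_map \<delta>' id (deconc (gen w)) + tensor_map (sign_map A) \<delta>' (deconc (gen w))))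
         + (\<Sum>i = 1..<length w. tens (\<delta> (gen (take i w)) - \<delta>' (gen (take i w))) (gen (drop i w))
             + tens (sign_map A (gen (take i w))) (\<delta> (gen (drop i w)) - \<delta>' (gen (drop i w))))"
        unfolding deconc_linear[THEN module_hom.diff] tensor_map_deconc_gen
        by (simp add: tens_simps sum.distrib sum_subtractf algebra_simps)
      moreover have "\<dots> \<in> tc2_rel s"
      proof (rule free.subspace_add[OF subspace_tc2_rel free.subspace_diff[OF subspace_tc2_rel
              coderivation_deconc[OF assms(2)] coderivation_deconc[OF assms(3)]]],
          rule free.subspace_sum[OF subspace_tc2_rel], rule free.subspace_add[OF subspace_tc2_rel])
        fix i assume i: "i \<in> {1..<length w}"
        show "tens (\<delta> (gen (take i w)) - \<delta>' (gen (take i w))) (gen (drop i w)) \<in> tc2_rel s"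
          by (rule tens_tc2_left) (use 1 i in auto)
        show "tens (sign_map A (gen (take i w))) (\<delta> (gen (drop i w)) - \<delta>' (gen (drop i w))) \<in> tc2_rel s"
          by (rule tens_tc2_right) (use 1 i in auto)
      qed
      ultimately show ?case
        by (intro tc_rel_if_deconc_proj[OF module_axioms])
          (simp_all add: tc_proj_linear[OF module_axioms, THEN module_hom.diff] assms(4))
    qed
  qed simp
qed

text \<open>A coderivation that is only known modulo relations need not map a word to a combination of
  words of bounded length, hence the relations are part of each step of the filtration.\<close>

definition length_filtration ::
  "('r::comm_ring_1 \<Rightarrow> 'a::ab_group_add \<Rightarrow> 'a) \<Rightarrow> nat \<Rightarrow> ('a list \<Rightarrow>\<^sub>0 'r) set" where
  "length_filtration s n = free.span ({gen w | w. length w \<le> n} \<union> tc_rel s)"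

lemma subspace_length_filtration [simp]: "free.subspace (length_filtration s n)"
  by (simp add: length_filtration_def)

lemma gen_length_filtration: "length w \<le> n \<Longrightarrow> gen w \<in> length_filtration s n"
  unfolding length_filtration_def by (rule free.span_base) blast

lemma tc_rel_length_filtration: "x \<in> tc_rel s \<Longrightarrow> x \<in> length_filtration s n"
  unfolding length_filtration_def by (rule free.span_base) blast

lemma free_linear_length_filtration:
  assumes "free_linear \<theta>" "free.subspace N" "\<And>x. x \<in> tc_rel s \<Longrightarrow> \<theta> x \<in> N"
    "\<And>w. length w \<le> n \<Longrightarrow> \<theta> (gen w) \<in> N" "x \<in> length_filtration s n"
  shows "\<theta> x \<in> N"
  using assms(5) unfolding length_filtration_def
  by (rule free_linear_span_mem[OF assms(1,2), rotated]) (use assms(3,4) in blast)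

text \<open>By \<open>tc_decompose\<close> it is enough to bound the length of what \<open>reattach\<close> makes of the coproduct.
  It keeps only terms whose left factor is a single letter. The right factor is either a proper suffix of the
  word or, by induction, in the filtration step given by the length of such a suffix.\<close>

lemma coderivation_length_filtration:
  assumes "module s" "tc_coderivation s A \<delta>" "x \<in> length_filtration s n"
  shows "\<delta> x \<in> length_filtration s n"
proof -
  have \<delta>: "tc_map s A s A (- 1) \<delta>"
    using assms(2) by (simp add: tc_coderivation_def)
  note R = reattach_linear
  have word: "\<delta> (gen w) \<in> length_filtration s n" if "length w \<le> n" for w n
    using that
  proof (induction w arbitrary: n rule: length_induct)
    case (1 w)
    show ?case
    proof (cases "w = []")
      case True
      then show ?thesis
        by (simp add: tc_map_tc_rel[OF \<delta>] tc_rel_length_filtration)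
    next
      case False
      let ?F = "length_filtration s n"
      have left: "reattach (tens x (gen v)) \<in> ?F" if "length v < length w" for x v
      proof (rule free_linear_mem[OF module_hom_comp[OF tens_linear_left R] subspace_length_filtration])
        fix u
        show "reattach (tens (gen u) (gen v)) \<in> ?F"
          using that 1 by (auto intro!: gen_length_filtration free.subspace_0)
      qed
      have right: "reattach (tens (gen u) y) \<in> ?F" if "m < length w" "y \<in> length_filtration s m" for u y m
      proof (rule free_linear_length_filtration[OF module_hom_comp[OF tens_linear_right R]
            subspace_length_filtration _ _ that(2)])
        show "reattach (tens (gen u) x) \<in> ?F" if "x \<in> tc_rel s" for x
          by (intro tc_rel_length_filtration reattach_tens_rel_right that)
        show "reattach (tens (gen u) (gen v)) \<in> ?F" if "length v \<le> m" for v
          using that \<open>m < length w\<close> 1 by (auto intro!: gen_length_filtration free.subspace_0)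
      qed
      let ?e = "tensor_map \<delta> id (deconc (gen w)) + tensor_map (sign_map A) \<delta> (deconc (gen w))"
      have "reattach ?e \<in> ?F"
        unfolding tensor_map_deconc_gen R[THEN module_hom.add] R[THEN module_hom.sum]
      proof (intro free.subspace_add free.subspace_sum subspace_length_filtration)
        fix i assume i: "i \<in> {1..<length w}"
        then show "reattach (tens (\<delta> (gen (take i w))) (id (gen (drop i w)))) \<in> ?F"
          by (auto intro!: left)
        show "reattach (tens (sign_map A (gen (take i w))) (\<delta> (gen (drop i w)))) \<in> ?F"
          unfolding sign_map_gen
          by (rule right[of "length (drop i w)"]) (use i 1 in auto)
      qed
      moreover have "reattach (deconc (\<delta> (gen w)) - ?e) \<in> ?F"
        by (intro tc_rel_length_filtration reattach_tc2_rel coderivation_deconc assms)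
      ultimately have "reattach (deconc (\<delta> (gen w))) \<in> ?F"
        using free.subspace_add[OF subspace_length_filtration, of "reattach (deconc (\<delta> (gen w)) - ?e)" s n]
        by (fastforce simp only: R[THEN module_hom.diff] diff_add_cancel)
      moreover have "gen [tc_proj s (\<delta> (gen w))] \<in> ?F"
        using False 1 by (intro gen_length_filtration) (auto simp: Suc_le_eq intro: order_less_le_trans)
      moreover have "\<delta> (gen w) - reattach (deconc (\<delta> (gen w))) - gen [tc_proj s (\<delta> (gen w))] \<in> ?F"
        by (intro tc_rel_length_filtration tc_decompose assms)
      ultimately have "\<delta> (gen w) - reattach (deconc (\<delta> (gen w))) - gen [tc_proj s (\<delta> (gen w))]
          + gen [tc_proj s (\<delta> (gen w))] + reattach (deconc (\<delta> (gen w))) \<in> ?F"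
        by (intro free.subspace_add[OF subspace_length_filtration])
      then show ?thesis by simp
    qed
  qed
  show ?thesis
    by (rule free_linear_length_filtration[OF tc_map_linear[OF \<delta>] _ _ _ assms(3)])
      (auto intro: word tc_rel_length_filtration tc_map_tc_rel[OF \<delta>])
qed

section \<open>Maps with prescribed components\<close>

definition attach :: "'b \<Rightarrow> ('b list \<Rightarrow>\<^sub>0 'r::comm_ring_1) \<Rightarrow> ('b list \<Rightarrow>\<^sub>0 'r)" where
  "attach b = lin_ext fscale (\<lambda>v. gen (b # v))"

lemma attach_linear: "free_linear (attach b)"
  unfolding attach_def by (rule free_lin_ext_linear)

lemma attach_gen [simp]: "attach b (gen v) = gen (b # v)"
  by (simp add: attach_def)

lemma drop_shorter: "i \<in> {1..length w} \<Longrightarrow> length (drop i w) < length w"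
  unfolding length_drop atLeastAtMost_iff by linarith

text \<open>The sum over all decompositions of the word into consecutive nonempty blocks, with \<open>Q\<close> applied to
  each block. The empty word has one decomposition, without blocks.\<close>

function cofree_morphism :: "('a list \<Rightarrow> 'b) \<Rightarrow> 'a list \<Rightarrow> ('b list \<Rightarrow>\<^sub>0 'r::comm_ring_1)" where
  "cofree_morphism Q w = (if w = [] then gen []
     else (\<Sum>i = 1..length w. attach (Q (take i w)) (cofree_morphism Q (drop i w))))"
  by pat_completeness auto
termination by (relation "measure (\<lambda>(Q, w). length w)") auto

text \<open>The sum over all decompositions into blocks of which one is marked: \<open>P\<close> is applied to the blocks
  before the marked block, \<open>H\<close> to the marked block and \<open>Q\<close> to the blocks after it.\<close>

function cofree_homotopy ::
  "('a list \<Rightarrow> 'b) \<Rightarrow> ('a list \<Rightarrow> 'b) \<Rightarrow> ('a list \<Rightarrow> 'b) \<Rightarrow> 'a list \<Rightarrow> ('b list \<Rightarrow>\<^sub>0 'r::comm_ring_1)" where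
  "cofree_homotopy P H Q w =
     (\<Sum>i = 1..length w. attach (P (take i w)) (cofree_homotopy P H Q (drop i w))
        + attach (H (take i w)) (cofree_morphism Q (drop i w)))"
  by pat_completeness auto
termination by (relation "measure (\<lambda>(P, H, Q, w). length w)") auto

declare cofree_morphism.simps [simp del] cofree_homotopy.simps [simp del]

lemma cofree_morphism_Nil [simp]: "cofree_morphism Q [] = gen []"
  by (subst cofree_morphism.simps) simp

lemma cofree_homotopy_Nil [simp]: "cofree_homotopy P H Q [] = 0"
  by (subst cofree_homotopy.simps) simp

lemma cofree_morphism_nonempty:
  "w \<noteq> [] \<Longrightarrow> cofree_morphism Q w = (\<Sum>i = 1..length w. attach (Q (take i w)) (cofree_morphism Q (drop i w)))"
  by (subst cofree_morphism.simps) simp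

lemma cofree_morphism_take:
  assumes "k \<in> {1..length w}"
  shows "cofree_morphism Q (take k w)
    = (\<Sum>i = 1..k. attach (Q (take i w)) (cofree_morphism Q (drop i (take k w))))"
proof -
  have "take k w \<noteq> []" "length (take k w) = k" using assms by (auto simp: Suc_le_eq)
  then show ?thesis
    by (subst cofree_morphism_nonempty) (auto intro!: sum.cong simp: min_def)
qed

lemma cofree_homotopy_take:
  assumes "k \<in> {1..length w}"
  shows "cofree_homotopy P H Q (take k w)
    = (\<Sum>i = 1..k. attach (P (take i w)) (cofree_homotopy P H Q (drop i (take k w)))
        + attach (H (take i w)) (cofree_morphism Q (drop i (take k w))))"
  using assms by (subst cofree_homotopy.simps) (auto intro!: sum.cong simp: min_def)

lemma cofree_morphism_cong:
  assumes "\<And>v. length v \<le> length w \<Longrightarrow> Q v = Q' v"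
  shows "cofree_morphism Q w = cofree_morphism Q' w"
  using assms
proof (induction w rule: length_induct)
  case (1 w)
  show ?case
  proof (cases "w = []")
    case False
    then show ?thesis
      unfolding cofree_morphism_nonempty[OF False]
      using 1 by (intro sum.cong arg_cong2[of _ _ _ _ attach]) auto
  qed simp
qed

text \<open>The marked block is nonempty, so \<open>Q\<close> is only used on shorter words. As a congruence rule
  this makes it possible to define \<open>Q\<close> by recursion through \<open>cofree_homotopy\<close>.\<close>

lemma cofree_homotopy_cong [fundef_cong]:
  assumes "P = P'" "H = H'" "w = w'" "\<And>v. length v < length w' \<Longrightarrow> Q v = Q' v"
  shows "cofree_homotopy P H Q w = cofree_homotopy P' H' Q' w'"
  using assms(4) unfolding assms(1-3)
proof (induction w' rule: length_induct)
  case (1 w)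
  then show ?case
    unfolding cofree_homotopy.simps[of _ _ _ w]
    by (intro sum.cong arg_cong2[of _ _ _ _ "(+)"] arg_cong2[of _ _ _ _ attach] cofree_morphism_cong) auto
qed

text \<open>Deconcatenation including the two trivial cuts. With them the coproduct formulas below are
  identities of representatives, whereas \<open>deconc\<close> agrees with it only modulo \<open>tc2_rel\<close>.\<close>

definition full_deconc :: "('a list \<Rightarrow>\<^sub>0 'r::comm_ring_1) \<Rightarrow> ('a list \<times> 'a list \<Rightarrow>\<^sub>0 'r)" where
  "full_deconc = lin_ext fscale (\<lambda>w. \<Sum>i\<le>length w. tens (gen (take i w)) (gen (drop i w)))"

lemma full_deconc_linear: "free_linear full_deconc"
  unfolding full_deconc_def by (rule free_lin_ext_linear)

lemma full_deconc_gen: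
  "full_deconc (gen w) = (\<Sum>i\<le>length w. tens (gen (take i w)) (gen (drop i w)))"
  by (simp add: full_deconc_def)

lemma full_deconc_attach:
  "full_deconc (attach b p) = tens (gen []) (attach b p) + tensor_map (attach b) id (full_deconc p)"
  by (rule hom_eq_on_gens[OF module_hom_comp[OF attach_linear full_deconc_linear]
        module_hom_plus[OF module_hom_comp[OF attach_linear tens_linear_right]
          module_hom_comp[OF full_deconc_linear tensor_map_linear]]])
     (simp add: full_deconc_gen tensor_map_linear[THEN module_hom.sum] sum.atMost_Suc_shift del: sum.atMost_Suc)

text \<open>Cutting off a first block of length \<open>i\<close> and then cutting the rest \<open>j\<close> letters further amounts
  to cutting at \<open>k = j + i\<close> and then cutting off a first block from the left part.\<close>

lemma sum_over_nested_cuts: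
  fixes F :: "nat \<Rightarrow> nat \<Rightarrow> 'x::comm_monoid_add"
  shows "(\<Sum>i = 1..n. \<Sum>j\<le>n - i. F i (j + i)) = (\<Sum>k = 1..n. \<Sum>i = 1..k. F i k)"
proof -
  have "(\<Sum>j\<le>n - i. F i (j + i)) = (\<Sum>k | k \<in> {1..n} \<and> i \<le> k. F i k)" if "i \<in> {1..n}" for i
    by (rule sum.reindex_bij_witness[of _ "\<lambda>k. k - i" "\<lambda>j. j + i"]) (use that in auto)
  then have "(\<Sum>i = 1..n. \<Sum>j\<le>n - i. F i (j + i)) = (\<Sum>i = 1..n. \<Sum>k | k \<in> {1..n} \<and> i \<le> k. F i k)"
    by (rule sum.cong[OF refl])
  also have "\<dots> = (\<Sum>k = 1..n. \<Sum>i | i \<in> {1..n} \<and> i \<le> k. F i k)"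
    by (rule sum.swap_restrict) auto
  also have "\<dots> = (\<Sum>k = 1..n. \<Sum>i = 1..k. F i k)"
    by (intro sum.cong refl) auto
  finally show ?thesis .
qed

lemma sum_atMost_first: "(\<Sum>k\<le>n. f k) = f 0 + (\<Sum>k = 1..n. f k)" for f :: "nat \<Rightarrow> 'x::comm_monoid_add"
  by (simp add: atMost_atLeast0 sum.atLeast_Suc_atMost)

text \<open>A cut of the word of values is a cut of the original word together with decompositions of both
  parts into blocks.\<close>

lemma full_deconc_cofree_morphism:
  fixes Q :: "'a list \<Rightarrow> 'b"
  shows "full_deconc (cofree_morphism Q w :: 'b list \<Rightarrow>\<^sub>0 'r::comm_ring_1)
    = (\<Sum>k\<le>length w. tens (cofree_morphism Q (take k w)) (cofree_morphism Q (drop k w)))"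
proof (induction w rule: length_induct)
  case (1 w)
  let ?m = "cofree_morphism Q :: 'a list \<Rightarrow> ('b list \<Rightarrow>\<^sub>0 'r)" and ?n = "length w"
  show ?case
  proof (cases "w = []")
    case True
    then show ?thesis by (simp add: full_deconc_gen)
  next
    case False
    have step: "full_deconc (attach b (?m (drop i w))) = tens (gen []) (attach b (?m (drop i w)))
        + (\<Sum>j\<le>?n - i. tens (attach b (?m (drop i (take (j + i) w)))) (?m (drop (j + i) w)))"
      if "i \<in> {1..?n}" for b i
    proof -
      have "full_deconc (?m (drop i w))
          = (\<Sum>j\<le>?n - i. tens (?m (take j (drop i w))) (?m (drop j (drop i w))))"
        using 1[rule_format, OF drop_shorter[OF that]] by simp
      then show ?thesis
        by (simp add: full_deconc_attach tensor_map_linear[THEN module_hom.sum]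
            tensor_map_tens attach_linear free.module_hom_id take_drop)
    qed
    have "full_deconc (?m w) = (\<Sum>i = 1..?n. tens (gen []) (attach (Q (take i w)) (?m (drop i w)))
        + (\<Sum>j\<le>?n - i. tens (attach (Q (take i w)) (?m (drop i (take (j + i) w)))) (?m (drop (j + i) w))))"
      unfolding cofree_morphism_nonempty[OF False] full_deconc_linear[THEN module_hom.sum]
      by (rule sum.cong) (simp_all only: step)
    also have "\<dots> = tens (gen []) (?m w) + (\<Sum>k = 1..?n. tens (?m (take k w)) (?m (drop k w)))"
      unfolding sum.distrib sum_over_nested_cuts[of "\<lambda>i k. tens (attach (Q (take i w)) (?m (drop i (take k w)))) (?m (drop k w))"]
      by (simp add: cofree_morphism_take tens_linear_left[THEN module_hom.sum]
          tens_linear_right[THEN module_hom.sum] cofree_morphism_nonempty[OF False])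
    finally show ?thesis by (simp add: sum_atMost_first)
  qed
qed

text \<open>As before, except that the marked block lies either to the right or to the left of the cut.\<close>

lemma full_deconc_cofree_homotopy:
  fixes P H Q :: "'a list \<Rightarrow> 'b"
  defines "M \<equiv> cofree_morphism :: ('a list \<Rightarrow> 'b) \<Rightarrow> _ \<Rightarrow> ('b list \<Rightarrow>\<^sub>0 'r::comm_ring_1)"
  shows "full_deconc (cofree_homotopy P H Q w :: 'b list \<Rightarrow>\<^sub>0 'r)
    = (\<Sum>k\<le>length w. tens (M P (take k w)) (cofree_homotopy P H Q (drop k w))
        + tens (cofree_homotopy P H Q (take k w)) (M Q (drop k w)))"
proof (induction w rule: length_induct)
  case (1 w)
  let ?h = "cofree_homotopy P H Q" and ?n = "length w"
  define F :: "nat \<Rightarrow> nat \<Rightarrow> ('b list \<times> 'b list \<Rightarrow>\<^sub>0 'r)" where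
    "F i k = tens (attach (P (take i w)) (M P (drop i (take k w)))) (?h (drop k w))
       + tens (attach (P (take i w)) (?h (drop i (take k w)))
           + attach (H (take i w)) (M Q (drop i (take k w)))) (M Q (drop k w))" for i k
  note T = full_deconc_attach tensor_map_linear[THEN module_hom.sum] tensor_map_linear[THEN module_hom.add]
    tensor_map_tens attach_linear free.module_hom_id take_drop
  have "full_deconc (?h w) = (\<Sum>i = 1..?n. full_deconc (attach (P (take i w)) (?h (drop i w)))
      + full_deconc (attach (H (take i w)) (M Q (drop i w))))"
    unfolding cofree_homotopy.simps[of _ _ _ w] full_deconc_linear[THEN module_hom.sum]
      full_deconc_linear[THEN module_hom.add] M_def ..
  also have "\<dots> = (\<Sum>i = 1..?n. tens (gen []) (attach (P (take i w)) (?h (drop i w))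
      + attach (H (take i w)) (M Q (drop i w))) + (\<Sum>j\<le>?n - i. F i (j + i)))"
  proof (rule sum.cong[OF refl])
    fix i assume i: "i \<in> {1..?n}"
    have IH: "full_deconc (?h (drop i w)) = (\<Sum>j\<le>?n - i. tens (M P (take j (drop i w))) (?h (drop j (drop i w)))
        + tens (?h (take j (drop i w))) (M Q (drop j (drop i w))))"
      using 1[rule_format, OF drop_shorter[OF i]] by simp
    have M: "full_deconc (M Q (drop i w)) = (\<Sum>j\<le>?n - i. tens (M Q (take j (drop i w))) (M Q (drop j (drop i w))))"
      unfolding M_def full_deconc_cofree_morphism by simp
    show "full_deconc (attach (P (take i w)) (?h (drop i w))) + full_deconc (attach (H (take i w)) (M Q (drop i w)))
      = tens (gen []) (attach (P (take i w)) (?h (drop i w)) + attach (H (take i w)) (M Q (drop i w)))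
        + (\<Sum>j\<le>?n - i. F i (j + i))"
      by (simp add: T IH M F_def tens_simps sum.distrib algebra_simps)
  qed
  also have "\<dots> = tens (gen []) (?h w) + (\<Sum>k = 1..?n. \<Sum>i = 1..k. F i k)"
    unfolding sum.distrib sum_over_nested_cuts
    by (simp add: cofree_homotopy.simps[of _ _ _ w] tens_linear_right[THEN module_hom.sum] M_def)
  also have "(\<Sum>k = 1..?n. \<Sum>i = 1..k. F i k)
     = (\<Sum>k = 1..?n. tens (M P (take k w)) (?h (drop k w)) + tens (?h (take k w)) (M Q (drop k w)))"
    by (rule sum.cong) (simp_all add: F_def cofree_homotopy_take cofree_morphism_take M_def
        tens_linear_left[THEN module_hom.sum] tens_linear_left[THEN module_hom.add] sum.distrib)
  finally show ?case by (simp add: sum_atMost_first M_def tens_simps)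
qed

lemma sum_without_ends:
  fixes n :: nat
  assumes "free.subspace N" "f 0 \<in> N" "f n \<in> N"
  shows "(\<Sum>i\<le>n. f i) - (\<Sum>i = 1..<n. f i) \<in> N"
proof (cases n)
  case 0
  then show ?thesis using assms by simp
next
  case (Suc m)
  have "{1..n} = insert n {1..<n}" using Suc by auto
  then have "(\<Sum>i\<le>n. f i) - (\<Sum>i = 1..<n. f i) = f 0 + f n"
    by (simp add: sum_atMost_first)
  then show ?thesis using free.subspace_add[OF assms] by simp
qed

lemma full_deconc_deconc: "full_deconc x - deconc x \<in> tc2_rel s"
proof (rule free_linear_mem[OF module_hom_minus[OF full_deconc_linear deconc_linear]])
  fix w show "full_deconc (gen w) - deconc (gen w) \<in> tc2_rel s"
    unfolding full_deconc_gen deconc_gen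
    by (rule sum_without_ends) (simp_all add: tens_tc2_left tens_tc2_right del: tens_gen)
qed simp

lemma deconc_if_full_deconc:
  fixes n :: nat
  assumes "full_deconc x = (\<Sum>i\<le>n. f i)" "f 0 \<in> tc2_rel s" "f n \<in> tc2_rel s"
  shows "deconc x - (\<Sum>i = 1..<n. f i) \<in> tc2_rel s"
  using free.subspace_diff[OF subspace_tc2_rel sum_without_ends[OF subspace_tc2_rel, of f s n]
      full_deconc_deconc[of x s]] assms by simp

lemma deconc_cofree_morphism:
  "deconc (cofree_morphism Q w)
    - (\<Sum>k = 1..<length w. tens (cofree_morphism Q (take k w)) (cofree_morphism Q (drop k w))) \<in> tc2_rel s"
  by (rule deconc_if_full_deconc[OF full_deconc_cofree_morphism])
     (simp_all add: tens_tc2_left tens_tc2_right)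

lemma deconc_cofree_homotopy:
  "deconc (cofree_homotopy P H Q w)
    - (\<Sum>k = 1..<length w. tens (cofree_morphism P (take k w)) (cofree_homotopy P H Q (drop k w))
        + tens (cofree_homotopy P H Q (take k w)) (cofree_morphism Q (drop k w))) \<in> tc2_rel s"
  by (rule deconc_if_full_deconc[OF full_deconc_cofree_homotopy])
     (simp_all add: tens_tc2_left tens_tc2_right tens_simps)

lemma lookup_Nil_attach [simp]: "Poly_Mapping.lookup (attach b p) [] = 0"
proof -
  have "attach b p \<in> {q. Poly_Mapping.lookup q [] = 0}"
    by (rule free_linear_mem[OF attach_linear])
       (auto simp: free.subspace_def lookup_add lookup_fscale lookup_single)
  then show ?thesis by simp
qed

lemma lookup_Nil_cofree_morphism:
  "Poly_Mapping.lookup (cofree_morphism Q w :: 'b list \<Rightarrow>\<^sub>0 'r::comm_ring_1) [] = (if w = [] then 1 else 0)"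
  by (cases "w = []") (simp_all add: cofree_morphism_nonempty lookup_sum)

lemma lookup_Nil_cofree_homotopy:
  "Poly_Mapping.lookup (cofree_homotopy P H Q w) [] = 0"
  by (subst cofree_homotopy.simps) (simp add: lookup_sum lookup_add)

lemma tc_proj_attach:
  assumes "module s"
  shows "tc_proj s (attach b p) = s (Poly_Mapping.lookup p []) b"
proof -
  interpret module s by fact
  have "module_hom fscale s (\<lambda>p. s (Poly_Mapping.lookup p []) b)"
    by (simp add: module_hom_iff module_axioms lookup_add lookup_fscale scale_left_distrib)
  then show ?thesis
    by (rule hom_eq_on_gens[OF module_hom_comp[OF attach_linear tc_proj_linear[OF assms]]])
       (simp add: tc_proj_gen[OF assms] lookup_single when_def)
qed

lemma tc_proj_cofree_morphism:
  assumes "module s" "w \<noteq> []"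
  shows "tc_proj s (cofree_morphism Q w) = Q w"
proof -
  interpret module s by fact
  have "tc_proj s (cofree_morphism Q w) = (\<Sum>i = 1..length w. if i = length w then Q w else 0)"
    unfolding cofree_morphism_nonempty[OF assms(2)] tc_proj_linear[OF assms(1), THEN module_hom.sum]
    by (rule sum.cong) (auto simp: tc_proj_attach[OF assms(1)] lookup_Nil_cofree_morphism)
  then show ?thesis using assms(2) by (simp add: Suc_le_eq)
qed

lemma tc_proj_cofree_homotopy:
  assumes "module s" "w \<noteq> []"
  shows "tc_proj s (cofree_homotopy P H Q w) = H w"
proof -
  interpret module s by fact
  have "tc_proj s (cofree_homotopy P H Q w) = (\<Sum>i = 1..length w. if i = length w then H w else 0)"
    unfolding cofree_homotopy.simps[of _ _ _ w] tc_proj_linear[OF assms(1), THEN module_hom.sum]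
    by (rule sum.cong) (auto simp: tc_proj_attach[OF assms(1)] lookup_Nil_cofree_morphism
        lookup_Nil_cofree_homotopy tc_proj_linear[OF assms(1), THEN module_hom.add])
  then show ?thesis using assms(2) by (simp add: Suc_le_eq)
qed

lemma attach_homogeneous:
  assumes "b \<in> B m" "p \<in> homogeneous_span B e"
  shows "attach b p \<in> homogeneous_span B (m + 1 + e)"
proof (rule free_linear_homogeneous_span[OF attach_linear _ _ assms(2)])
  fix ns w assume "homogeneous_word B ns w" "tensor_degree ns = e"
  then show "attach b (gen w) \<in> homogeneous_span B (m + 1 + e)"
    using gen_homogeneous_span[of B "m # ns" "b # w"] assms(1) by simp
qed simp

lemma tensor_degree_take_drop: "tensor_degree (take i ns) + tensor_degree (drop i ns) = tensor_degree ns"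
  by (metis append_take_drop_id tensor_degree_simps(3))

lemma cofree_morphism_homogeneous:
  fixes Q :: "'a list \<Rightarrow> 'b"
  assumes "\<And>ns v. homogeneous_word A ns v \<Longrightarrow> v \<noteq> [] \<Longrightarrow> length v \<le> N \<Longrightarrow> Q v \<in> B (tensor_degree ns - 1)"
    "homogeneous_word A ns w" "length w \<le> N"
  shows "(cofree_morphism Q w :: 'b list \<Rightarrow>\<^sub>0 'r::comm_ring_1) \<in> homogeneous_span B (tensor_degree ns)"
  using assms(2,3)
proof (induction w arbitrary: ns rule: length_induct)
  case (1 w)
  let ?m = "cofree_morphism Q :: 'a list \<Rightarrow> ('b list \<Rightarrow>\<^sub>0 'r)"
  show ?case
  proof (cases "w = []")
    case True
    then show ?thesis using 1 gen_homogeneous_span[of B "[]" "[]"] by simp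
  next
    case False
    have "attach (Q (take i w)) (?m (drop i w)) \<in> homogeneous_span B (tensor_degree ns)"
      if i: "i \<in> {1..length w}" for i
    proof -
      have "Q (take i w) \<in> B (tensor_degree (take i ns) - 1)"
        using assms(1)[OF homogeneous_word_take[OF 1(2)]] 1(3) i False by auto
      moreover have "?m (drop i w) \<in> homogeneous_span B (tensor_degree (drop i ns))"
        using 1(1)[rule_format, OF drop_shorter[OF i], of "drop i ns"] le_trans[OF diff_le_self 1(3), of i] homogeneous_word_drop[OF 1(2)] 1(3) i by auto
      ultimately show ?thesis
        using attach_homogeneous tensor_degree_take_drop[of i ns] by fastforce
    qed
    then show ?thesis
      unfolding cofree_morphism_nonempty[OF False] by (intro free.subspace_sum subspace_homogeneous_span)
  qed
qed

lemma cofree_homotopy_homogeneous: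
  fixes P H Q :: "'a list \<Rightarrow> 'b"
  assumes P: "\<And>ns v. homogeneous_word A ns v \<Longrightarrow> v \<noteq> [] \<Longrightarrow> P v \<in> B (tensor_degree ns - 1)"
    and H: "\<And>ns v. homogeneous_word A ns v \<Longrightarrow> v \<noteq> [] \<Longrightarrow> H v \<in> B (tensor_degree ns)"
    and Q: "\<And>ns v. homogeneous_word A ns v \<Longrightarrow> v \<noteq> [] \<Longrightarrow> length v < N \<Longrightarrow> Q v \<in> B (tensor_degree ns - 1)"
    and "homogeneous_word A ns w" "length w \<le> N"
  shows "(cofree_homotopy P H Q w :: 'b list \<Rightarrow>\<^sub>0 'r::comm_ring_1) \<in> homogeneous_span B (tensor_degree ns + 1)"
  using assms(4,5)
proof (induction w arbitrary: ns rule: length_induct)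
  case (1 w)
  let ?m = "cofree_morphism Q :: 'a list \<Rightarrow> ('b list \<Rightarrow>\<^sub>0 'r)"
  let ?h = "cofree_homotopy P H Q :: 'a list \<Rightarrow> ('b list \<Rightarrow>\<^sub>0 'r)"
  have "attach (P (take i w)) (?h (drop i w))
       + attach (H (take i w)) (?m (drop i w)) \<in> homogeneous_span B (tensor_degree ns + 1)"
    if i: "i \<in> {1..length w}" for i
  proof -
    note u = homogeneous_word_take[OF 1(2), of i] and v = homogeneous_word_drop[OF 1(2), of i]
    have ne: "take i w \<noteq> []" using i by auto
    have "?h (drop i w) \<in> homogeneous_span B (tensor_degree (drop i ns) + 1)"
      using 1(1)[rule_format, OF drop_shorter[OF i], of "drop i ns"] le_trans[OF diff_le_self 1(3), of i] v 1(3) i by auto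
    from attach_homogeneous[OF P[OF u ne] this]
    have "attach (P (take i w)) (?h (drop i w)) \<in> homogeneous_span B (tensor_degree ns + 1)"
      using tensor_degree_take_drop[of i ns] by (simp add: algebra_simps)
    moreover have "?m (drop i w) \<in> homogeneous_span B (tensor_degree (drop i ns))"
      by (rule cofree_morphism_homogeneous[of A "length (drop i w)"]) (use Q v 1(3) i in auto)
    from attach_homogeneous[OF H[OF u ne] this]
    have "attach (H (take i w)) (?m (drop i w)) \<in> homogeneous_span B (tensor_degree ns + 1)"
      using tensor_degree_take_drop[of i ns] by (simp add: algebra_simps)
    ultimately show ?thesis by (rule free.subspace_add[OF subspace_homogeneous_span])
  qed
  then show ?case
    unfolding cofree_homotopy.simps[of _ _ _ w] by (intro free.subspace_sum subspace_homogeneous_span)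
qed

lemma word_relations_add:
  "length xs + 1 + length ys = n \<Longrightarrow>
    gen (xs @ [x + y] @ ys) - gen (xs @ [x] @ ys) - gen (xs @ [y] @ ys) \<in> word_relations s n"
  unfolding word_relations_def by blast

lemma word_relations_scale:
  "length xs + 1 + length ys = n \<Longrightarrow>
    gen (xs @ [s c x] @ ys) - fscale c (gen (xs @ [x] @ ys)) \<in> word_relations s n"
  unfolding word_relations_def by blast

text \<open>A cut leaves the letter that varies in the relation in one of the two factors, which thereby
  becomes a shorter relation.\<close>

lemma tensor_map_word_relations:
  assumes p: "free_linear p" "\<And>m r. m < n \<Longrightarrow> r \<in> word_relations sA m \<Longrightarrow> p r \<in> tc_rel sB"
    and q: "free_linear q" "\<And>m r. m < n \<Longrightarrow> r \<in> word_relations sA m \<Longrightarrow> q r \<in> tc_rel sB"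
    and r: "r \<in> word_relations sA n"
  shows "tensor_map p q (deconc r) \<in> tc2_rel sB"
proof -
  note L = tensor_map_linear[THEN module_hom.diff] tensor_map_linear[THEN module_hom.scale]
    deconc_linear[THEN module_hom.diff] deconc_linear[THEN module_hom.scale] tensor_map_deconc_gen
  note D = p(1)[THEN module_hom.diff] q(1)[THEN module_hom.diff] p(1)[THEN module_hom.scale]
    q(1)[THEN module_hom.scale]
  let ?t = "\<lambda>i w. tens (p (gen (take i w))) (q (gen (drop i w)))"
  from r show ?thesis
    unfolding word_relations_def
  proof (elim UnE CollectE exE conjE)
    fix xs ys x y
    assume r: "r = gen (xs @ [x + y] @ ys) - gen (xs @ [x] @ ys) - gen (xs @ [y] @ ys)"
      and n: "length xs + 1 + length ys = n"
    have "?t i (xs @ [x + y] @ ys) - ?t i (xs @ [x] @ ys) - ?t i (xs @ [y] @ ys) \<in> tc2_rel sB"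
      if i: "i \<in> {1..<n}" for i
    proof (cases "i \<le> length xs")
      case True
      have "tens (p (gen (take i xs))) (q (gen (drop i xs @ [x + y] @ ys) - gen (drop i xs @ [x] @ ys)
          - gen (drop i xs @ [y] @ ys))) \<in> tc2_rel sB"
        by (rule tens_tc2_right, rule q(2)[of "n - i"], use i in simp, rule word_relations_add)
          (use i n True in simp)
      then show ?thesis using True by (simp add: D tens_simps)
    next
      case False
      define k where "k = i - length xs - 1"
      have k: "i = Suc (length xs + k)" using False by (simp add: k_def)
      have "tens (p (gen (xs @ [x + y] @ take k ys) - gen (xs @ [x] @ take k ys)
          - gen (xs @ [y] @ take k ys))) (q (gen (drop k ys))) \<in> tc2_rel sB"
        by (rule tens_tc2_left, rule p(2)[of i], use i in simp, rule word_relations_add)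
          (use i n k in simp)
      then show ?thesis using k by (simp add: D tens_simps)
    qed
    then have "(\<Sum>i = 1..<n. ?t i (xs @ [x + y] @ ys) - ?t i (xs @ [x] @ ys) - ?t i (xs @ [y] @ ys)) \<in> tc2_rel sB"
      by (rule free.subspace_sum[OF subspace_tc2_rel])
    then show ?thesis
      using n by (simp add: r L sum_subtractf)
  next
    fix xs c x ys
    assume r: "r = gen (xs @ [sA c x] @ ys) - fscale c (gen (xs @ [x] @ ys))"
      and n: "length xs + 1 + length ys = n"
    have "?t i (xs @ [sA c x] @ ys) - fscale c (?t i (xs @ [x] @ ys)) \<in> tc2_rel sB"
      if i: "i \<in> {1..<n}" for i
    proof (cases "i \<le> length xs")
      case True
      have "tens (p (gen (take i xs))) (q (gen (drop i xs @ [sA c x] @ ys)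
          - fscale c (gen (drop i xs @ [x] @ ys)))) \<in> tc2_rel sB"
        by (rule tens_tc2_right, rule q(2)[of "n - i"], use i in simp, rule word_relations_scale)
          (use i n True in simp)
      then show ?thesis using True by (simp add: D tens_simps tens_linear_right[THEN module_hom.scale])
    next
      case False
      define k where "k = i - length xs - 1"
      have k: "i = Suc (length xs + k)" using False by (simp add: k_def)
      have "tens (p (gen (xs @ [sA c x] @ take k ys) - fscale c (gen (xs @ [x] @ take k ys))))
          (q (gen (drop k ys))) \<in> tc2_rel sB"
        by (rule tens_tc2_left, rule p(2)[of i], use i in simp, rule word_relations_scale)
          (use i n k in simp)
      then show ?thesis using k by (simp add: D tens_simps tens_linear_left[THEN module_hom.scale])
    qed
    then have "(\<Sum>i = 1..<n. ?t i (xs @ [sA c x] @ ys) - fscale c (?t i (xs @ [x] @ ys))) \<in> tc2_rel sB"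
      by (rule free.subspace_sum[OF subspace_tc2_rel])
    then show ?thesis
      using n by (simp add: r L sum_subtractf free.scale_sum_right)
  qed
qed

lemma morphism_deconc:
  assumes "tc_morphism sA A sB B \<phi>"
  shows "deconc (\<phi> x) - tensor_map \<phi> \<phi> (deconc x) \<in> tc2_rel sB"
  using assms by (simp add: tc_morphism_def tmap_tensor_map)

lemma tens_diff_mem:
  assumes "x - x' \<in> tc_rel s" "y - y' \<in> tc_rel s"
  shows "tens x y - tens x' y' \<in> tc2_rel s"
proof -
  have "tens x y - tens x' y' = tens (x - x') y + tens x' (y - y')"
    by (simp add: tens_simps)
  then show ?thesis
    using assms by (simp add: free.subspace_add tens_tc2_left tens_tc2_right)
qed

text \<open>The coproducts of both sides on a word are determined by the values on shorter words, and the
  projections agree.\<close>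

lemma morphism_cofree:
  assumes "module sB" "tc_morphism sA A sB B \<phi>"
  shows "\<phi> (gen w) - cofree_morphism (\<lambda>v. tc_proj sB (\<phi> (gen v))) w \<in> tc_rel sB"
proof (induction w rule: length_induct)
  case (1 w)
  have \<phi>: "tc_map sA A sB B 0 \<phi>" using assms(2) by (simp add: tc_morphism_def)
  let ?m = "cofree_morphism (\<lambda>v. tc_proj sB (\<phi> (gen v)))"
  show ?case
  proof (cases "w = []")
    case True
    then show ?thesis by (simp add: free.subspace_diff tc_map_tc_rel[OF \<phi>])
  next
    case False
    let ?e = "\<Sum>i = 1..<length w. tens (?m (take i w)) (?m (drop i w))"
    have "(\<Sum>i = 1..<length w. tens (\<phi> (gen (take i w))) (\<phi> (gen (drop i w)))
        - tens (?m (take i w)) (?m (drop i w))) \<in> tc2_rel sB"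
      by (intro free.subspace_sum subspace_tc2_rel tens_diff_mem 1[rule_format]) auto
    from free.subspace_add[OF subspace_tc2_rel morphism_deconc[OF assms(2), of "gen w"]
        free.subspace_diff[OF subspace_tc2_rel this deconc_cofree_morphism[of "\<lambda>v. tc_proj sB (\<phi> (gen v))" w]]]
    have "deconc (\<phi> (gen w) - ?m w) \<in> tc2_rel sB"
      by (simp add: tensor_map_deconc_gen sum_subtractf deconc_linear[THEN module_hom.diff])
    then show ?thesis
      by (rule tc_rel_if_deconc_proj[OF assms(1)])
        (simp add: tc_proj_linear[OF assms(1), THEN module_hom.diff] tc_proj_cofree_morphism[OF assms(1) False])
  qed
qed

section \<open>Extending a chain homotopy to the tensor coalgebra\<close>

lemma cofree_morphism_map:
  "cofree_morphism (\<lambda>u. F (map g u)) w = cofree_morphism F (map g w)"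
proof (induction w rule: length_induct)
  case (1 w)
  show ?case
  proof (cases "w = []")
    case False
    then show ?thesis
      using 1 by (simp add: cofree_morphism_nonempty take_map drop_map)
  qed simp
qed

text \<open>The situation on the level of tensor coalgebras. The map \<open>h\<close> is an arbitrary map of degree one:
  starting from \<open>\<phi>\<close> and \<open>h\<close>, the linear part of \<open>\<psi>\<close> comes out as \<open>f + \<partial> h + h \<partial>\<close>, where \<open>f\<close> is that of \<open>\<phi>\<close>.\<close>

locale homotopy_extension =
  A: graded_module sA A + B: graded_module sB B
  for sA :: "'r::comm_ring_1 \<Rightarrow> 'a::ab_group_add \<Rightarrow> 'a" and A :: "int \<Rightarrow> 'a set"
    and sB :: "'r \<Rightarrow> 'b::ab_group_add \<Rightarrow> 'b" and B :: "int \<Rightarrow> 'b set" +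
  fixes \<delta>A :: "('a list \<Rightarrow>\<^sub>0 'r) \<Rightarrow> ('a list \<Rightarrow>\<^sub>0 'r)"
    and \<delta>B :: "('b list \<Rightarrow>\<^sub>0 'r) \<Rightarrow> ('b list \<Rightarrow>\<^sub>0 'r)"
    and \<phi> :: "('a list \<Rightarrow>\<^sub>0 'r) \<Rightarrow> ('b list \<Rightarrow>\<^sub>0 'r)"
    and h :: "'a \<Rightarrow> 'b"
  assumes coder_A: "tc_coderivation sA A \<delta>A" and square_A: "\<delta>A (\<delta>A x) \<in> tc_rel sA"
    and coder_B: "tc_coderivation sB B \<delta>B" and square_B: "\<delta>B (\<delta>B y) \<in> tc_rel sB"
    and morphism: "tc_morphism sA A sB B \<phi>"
    and chain_map: "\<delta>B (\<phi> x) - \<phi> (\<delta>A x) \<in> tc_rel sB"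
    and homotopy: "graded_map sA A sB B 1 h"
begin

lemmas map_A = coder_A[unfolded tc_coderivation_def, THEN conjunct1]
lemmas map_B = coder_B[unfolded tc_coderivation_def, THEN conjunct1]
lemmas map_\<phi> = morphism[unfolded tc_morphism_def, THEN conjunct1]
lemmas lin_A = tc_map_linear[OF map_A]
lemmas lin_B = tc_map_linear[OF map_B]
lemmas lin_\<phi> = tc_map_linear[OF map_\<phi>]
lemmas rel_A = tc_map_tc_rel[OF map_A]
lemmas rel_B = tc_map_tc_rel[OF map_B]
lemmas rel_\<phi> = tc_map_tc_rel[OF map_\<phi>]
lemmas proj_A = tc_proj_linear[OF A.module_axioms]
lemmas proj_B = tc_proj_linear[OF B.module_axioms]

lemma h_linear: "module_hom sA sB h"
  using homotopy by (simp add: graded_map_def)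

lemma h_degree: "x \<in> A n \<Longrightarrow> h x \<in> B (n + 1)"
  using homotopy by (auto simp: graded_map_def)

text \<open>The components of \<open>\<phi> \<circ> S\<close>, where \<open>S\<close> is \<open>sign_map A\<close>: as \<open>\<eta>\<close> has degree one, the Koszul rule reads
  \<open>(\<phi> \<otimes> \<eta>) (x \<otimes> y) = \<phi> (S x) \<otimes> \<eta> y\<close>.\<close>

definition twisted_\<phi> :: "'a list \<Rightarrow> 'b" where
  "twisted_\<phi> u = tc_proj sB (\<phi> (gen (map (\<lambda>a. - parity A a) u)))"

text \<open>The components \<open>(h, 0, 0, \<dots>)\<close>, since \<open>tc_proj\<close> kills words of any length but one.\<close>

definition h_component :: "'a list \<Rightarrow> 'b" where
  "h_component w = h (tc_proj sA (gen w))"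

text \<open>The projection of \<open>\<psi> = \<phi> + \<delta> \<eta> + \<eta> \<delta>\<close> to the cogenerators. In the last summand the projection of
  \<open>\<eta>\<close> has been replaced by \<open>h\<close> after projection. The recursion ends because \<open>cofree_homotopy\<close> uses its third
  argument on shorter words only.\<close>

function \<psi>_component :: "'a list \<Rightarrow> 'b" where
  "\<psi>_component w = tc_proj sB (\<phi> (gen w))
     + tc_proj sB (\<delta>B (cofree_homotopy twisted_\<phi> h_component \<psi>_component w))
     + h (tc_proj sA (\<delta>A (gen w)))"
  by pat_completeness auto
termination by (relation "measure length") auto

declare \<psi>_component.simps [simp del]

definition \<psi> :: "('a list \<Rightarrow>\<^sub>0 'r) \<Rightarrow> ('b list \<Rightarrow>\<^sub>0 'r)" where
  "\<psi> = lin_ext fscale (cofree_morphism \<psi>_component)"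

definition \<eta> :: "('a list \<Rightarrow>\<^sub>0 'r) \<Rightarrow> ('b list \<Rightarrow>\<^sub>0 'r)" where
  "\<eta> = lin_ext fscale (cofree_homotopy twisted_\<phi> h_component \<psi>_component)"

lemma \<psi>_linear: "free_linear \<psi>"
  unfolding \<psi>_def by (rule free_lin_ext_linear)

lemma \<eta>_linear: "free_linear \<eta>"
  unfolding \<eta>_def by (rule free_lin_ext_linear)

lemma \<psi>_gen: "\<psi> (gen w) = cofree_morphism \<psi>_component w"
  by (simp add: \<psi>_def)

lemma \<eta>_gen: "\<eta> (gen w) = cofree_homotopy twisted_\<phi> h_component \<psi>_component w"
  by (simp add: \<eta>_def)

lemma proj_\<eta>: "tc_proj sB (\<eta> x) = h (tc_proj sA x)"
proof (rule hom_eq_on_gens[OF module_hom_comp[OF \<eta>_linear proj_B] module_hom_comp[OF proj_A h_linear]])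
  fix w
  show "tc_proj sB (\<eta> (gen w)) = h (tc_proj sA (gen w))"
    by (cases "w = []") (simp_all add: \<eta>_gen tc_proj_cofree_homotopy[OF B.module_axioms] h_component_def
        proj_B[THEN module_hom.zero] h_linear[THEN module_hom.zero] tc_proj_gen[OF A.module_axioms])
qed

lemma proj_\<psi>: "tc_proj sB (\<psi> x) = tc_proj sB (\<phi> x) + tc_proj sB (\<delta>B (\<eta> x)) + h (tc_proj sA (\<delta>A x))"
proof (rule hom_eq_on_gens[OF module_hom_comp[OF \<psi>_linear proj_B]
      module_hom_plus[OF module_hom_plus[OF module_hom_comp[OF lin_\<phi> proj_B]
          module_hom_comp[OF \<eta>_linear module_hom_comp[OF lin_B proj_B]]]
        module_hom_comp[OF lin_A module_hom_comp[OF proj_A h_linear]]]])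
  fix w
  show "tc_proj sB (\<psi> (gen w)) = tc_proj sB (\<phi> (gen w)) + tc_proj sB (\<delta>B (\<eta> (gen w)))
      + h (tc_proj sA (\<delta>A (gen w)))"
  proof (cases "w = []")
    case True
    then show ?thesis
      by (simp add: \<psi>_gen \<eta>_gen tc_proj_gen[OF B.module_axioms] lin_B[THEN module_hom.zero]
          proj_B[THEN module_hom.zero] h_linear[THEN module_hom.zero]
          tc_proj_tc_rel[OF B.module_axioms rel_\<phi>] tc_proj_tc_rel[OF A.module_axioms rel_A])
  next
    case False
    then show ?thesis
      by (simp add: \<psi>_gen \<eta>_gen tc_proj_cofree_morphism[OF B.module_axioms] \<psi>_component.simps[of w])
  qed
qed

lemma deconc_\<psi>: "deconc (\<psi> x) - tensor_map \<psi> \<psi> (deconc x) \<in> tc2_rel sB"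
proof (rule free_linear_mem[OF module_hom_minus[OF module_hom_comp[OF \<psi>_linear deconc_linear]
        module_hom_comp[OF deconc_linear tensor_map_linear]]])
  fix w
  show "deconc (\<psi> (gen w)) - tensor_map \<psi> \<psi> (deconc (gen w)) \<in> tc2_rel sB"
    unfolding tensor_map_deconc_gen \<psi>_gen by (rule deconc_cofree_morphism)
qed simp

lemma cofree_twisted_\<phi>: "\<phi> (sign_map A (gen u)) - cofree_morphism twisted_\<phi> u \<in> tc_rel sB"
proof -
  have "(cofree_morphism twisted_\<phi> u :: 'b list \<Rightarrow>\<^sub>0 'r)
      = cofree_morphism (\<lambda>v. tc_proj sB (\<phi> (gen v))) (map (\<lambda>a. - parity A a) u)"
    unfolding twisted_\<phi>_def[abs_def] by (rule cofree_morphism_map)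
  then show ?thesis
    using morphism_cofree[OF B.module_axioms morphism, of "map (\<lambda>a. - parity A a) u"] by simp
qed

lemma deconc_\<eta>:
  "deconc (\<eta> x) - (tensor_map (\<lambda>x. \<phi> (sign_map A x)) \<eta> (deconc x) + tensor_map \<eta> \<psi> (deconc x)) \<in> tc2_rel sB"
proof (rule free_linear_mem[OF module_hom_minus[OF module_hom_comp[OF \<eta>_linear deconc_linear]
        module_hom_plus[OF module_hom_comp[OF deconc_linear tensor_map_linear]
          module_hom_comp[OF deconc_linear tensor_map_linear]]]])
  fix w
  let ?e = "\<Sum>i = 1..<length w. tens (\<phi> (sign_map A (gen (take i w)))) (\<eta> (gen (drop i w)))
     - tens (cofree_morphism twisted_\<phi> (take i w)) (\<eta> (gen (drop i w)))"
  have "?e \<in> tc2_rel sB"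
    by (intro free.subspace_sum tens_diff_mem cofree_twisted_\<phi>) (simp_all add: free.subspace_0)
  from free.subspace_diff[OF subspace_tc2_rel
      deconc_cofree_homotopy[of twisted_\<phi> h_component \<psi>_component w sB] this]
  show "deconc (\<eta> (gen w)) - (tensor_map (\<lambda>x. \<phi> (sign_map A x)) \<eta> (deconc (gen w))
      + tensor_map \<eta> \<psi> (deconc (gen w))) \<in> tc2_rel sB"
    unfolding tensor_map_deconc_gen \<eta>_gen \<psi>_gen by (simp add: sum.distrib sum_subtractf algebra_simps)
qed simp

lemma \<phi>_sign_linear: "free_linear (\<lambda>x. \<phi> (sign_map A x))"
  by (rule module_hom_comp[OF sign_map_linear lin_\<phi>])

lemma \<phi>_sign_tc_rel: "x \<in> tc_rel sA \<Longrightarrow> \<phi> (sign_map A x) \<in> tc_rel sB"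
  by (intro rel_\<phi> sign_map_tc_rel A.graded_module_axioms)

lemma \<phi>_sign_word_relations: "r \<in> word_relations sA m \<Longrightarrow> \<phi> (sign_map A r) \<in> tc_rel sB"
  using \<phi>_sign_tc_rel word_relations_subset by blast

text \<open>Relations of length \<open>n\<close> are mapped to elements whose coproduct vanishes by induction, see
  \<open>tensor_map_word_relations\<close>. Their projection vanishes for \<open>\<eta>\<close> because \<open>tc_proj\<close> kills relations, and for \<open>\<psi>\<close>
  by \<open>proj_\<psi>\<close>, once \<open>\<eta>\<close> is known to preserve the relation.\<close>

lemma word_relations_preserved:
  "\<forall>r \<in> word_relations sA n. \<psi> r \<in> tc_rel sB \<and> \<eta> r \<in> tc_rel sB"
proof (induction n rule: less_induct)
  case (less n)
  show ?case
  proof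
    fix r assume r: "r \<in> word_relations sA n"
    then have rel: "r \<in> tc_rel sA" using word_relations_subset by blast
    have "tensor_map (\<lambda>x. \<phi> (sign_map A x)) \<eta> (deconc r) + tensor_map \<eta> \<psi> (deconc r) \<in> tc2_rel sB"
      using less \<phi>_sign_word_relations
      by (intro free.subspace_add tensor_map_word_relations[OF _ _ _ _ r] \<phi>_sign_linear \<eta>_linear \<psi>_linear)
         auto
    from free.subspace_add[OF subspace_tc2_rel this deconc_\<eta>[of r]]
    have "\<eta> r \<in> tc_rel sB"
      by (intro tc_rel_if_deconc_proj[OF B.module_axioms])
        (simp_all add: proj_\<eta> tc_proj_tc_rel[OF A.module_axioms rel] h_linear[THEN module_hom.zero])
    moreover have "tensor_map \<psi> \<psi> (deconc r) \<in> tc2_rel sB"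
      using less by (intro tensor_map_word_relations[OF _ _ _ _ r] \<psi>_linear) auto
    from free.subspace_add[OF subspace_tc2_rel this deconc_\<psi>[of r]]
    have "\<psi> r \<in> tc_rel sB"
      by (intro tc_rel_if_deconc_proj[OF B.module_axioms])
        (simp_all add: proj_\<psi> tc_proj_tc_rel[OF B.module_axioms] tc_proj_tc_rel[OF A.module_axioms]
          rel_\<phi>[OF rel] rel_A[OF rel] rel_B[OF \<open>\<eta> r \<in> tc_rel sB\<close>] h_linear[THEN module_hom.zero])
    ultimately show "\<psi> r \<in> tc_rel sB \<and> \<eta> r \<in> tc_rel sB" by simp
  qed
qed

lemma \<psi>_tc_rel: "x \<in> tc_rel sA \<Longrightarrow> \<psi> x \<in> tc_rel sB"
  by (rule free_linear_tc_rel[OF \<psi>_linear subspace_tc_rel])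
     (use word_relations_preserved in \<open>auto simp: \<psi>_gen\<close>)

lemma \<eta>_tc_rel: "x \<in> tc_rel sA \<Longrightarrow> \<eta> x \<in> tc_rel sB"
  by (rule free_linear_tc_rel[OF \<eta>_linear subspace_tc_rel])
     (use word_relations_preserved in \<open>auto simp: \<eta>_gen free.subspace_0\<close>)

lemma map_sign_homogeneous:
  "homogeneous_word A ns u \<Longrightarrow> homogeneous_word A ns (map (\<lambda>a. - parity A a) u)"
proof (induction u arbitrary: ns)
  case (Cons a u)
  then obtain n ms where "ns = n # ms" "a \<in> A n" "homogeneous_word A ms u"
    by (auto simp: homogeneous_word_Cons)
  with Cons.IH[of ms] show ?case
    using A.subspace_neg[OF A.homogeneous_subspace] by (auto simp: A.parity_homogeneous signed_def)
qed simp

lemma gen_tc_deg: "homogeneous_word A ns w \<Longrightarrow> gen w \<in> tc_deg sA A (tensor_degree ns)"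
  by (intro homogeneous_span_tc_deg gen_homogeneous_span)

lemma proj_\<phi>_degree: "homogeneous_word A ns w \<Longrightarrow> tc_proj sB (\<phi> (gen w)) \<in> B (tensor_degree ns - 1)"
  using tc_proj_tc_deg[OF B.graded_module_axioms tc_map_tc_deg[OF map_\<phi> gen_tc_deg]] by simp

lemma twisted_\<phi>_degree: "homogeneous_word A ns w \<Longrightarrow> twisted_\<phi> w \<in> B (tensor_degree ns - 1)"
  unfolding twisted_\<phi>_def by (intro proj_\<phi>_degree map_sign_homogeneous)

lemma h_component_degree: "homogeneous_word A ns w \<Longrightarrow> h_component w \<in> B (tensor_degree ns)"
  unfolding h_component_def
  using h_degree[OF tc_proj_tc_deg[OF A.graded_module_axioms gen_tc_deg]] by simp

text \<open>The induction is on the length because \<open>\<eta>\<close> on a word of length \<open>n\<close> has the right degree once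
  \<open>\<psi>_component\<close> does on words of length less than \<open>n\<close>.\<close>

lemma \<psi>_component_degree:
  "homogeneous_word A ns w \<Longrightarrow> \<psi>_component w \<in> B (tensor_degree ns - 1)"
proof (induction w arbitrary: ns rule: length_induct)
  case (1 w)
  have "\<eta> (gen w) \<in> homogeneous_span B (tensor_degree ns + 1)"
    unfolding \<eta>_gen
    by (rule cofree_homotopy_homogeneous[OF _ _ _ 1(2) order_refl])
       (use 1(1) in \<open>auto simp: twisted_\<phi>_degree h_component_degree\<close>)
  then have "\<delta>B (\<eta> (gen w)) \<in> tc_deg sB B (tensor_degree ns)"
    using tc_map_tc_deg[OF map_B homogeneous_span_tc_deg] by fastforce
  then have "tc_proj sB (\<delta>B (\<eta> (gen w))) \<in> B (tensor_degree ns - 1)"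
    by (rule tc_proj_tc_deg[OF B.graded_module_axioms])
  moreover have "h (tc_proj sA (\<delta>A (gen w))) \<in> B (tensor_degree ns - 1)"
    using h_degree[OF tc_proj_tc_deg[OF A.graded_module_axioms tc_map_tc_deg[OF map_A gen_tc_deg[OF 1(2)]]]]
    by simp
  ultimately show ?case
    unfolding \<psi>_component.simps[of w] \<eta>_gen
    by (intro B.subspace_add[OF B.homogeneous_subspace] proj_\<phi>_degree 1(2))
qed

lemma map_\<psi>: "tc_map sA A sB B 0 \<psi>"
  unfolding tc_map_def
proof (intro conjI \<psi>_linear allI image_subsetI)
  fix n x assume "x \<in> tc_deg sA A n"
  then show "\<psi> x \<in> tc_deg sB B (n + 0)"
  proof (rule free_linear_tc_deg[OF \<psi>_linear subspace_tc_deg tc_rel_tc_deg[OF \<psi>_tc_rel], rotated 2])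
    fix ns w assume w: "homogeneous_word A ns w" "tensor_degree ns = n"
    have "\<psi> (gen w) \<in> homogeneous_span B (tensor_degree ns)"
      unfolding \<psi>_gen by (rule cofree_morphism_homogeneous[OF _ w(1) order_refl]) (rule \<psi>_component_degree)
    then show "\<psi> (gen w) \<in> tc_deg sB B (n + 0)" using w(2) by (simp add: homogeneous_span_tc_deg)
  qed
qed (rule \<psi>_tc_rel)

lemma map_\<eta>: "tc_map sA A sB B 1 \<eta>"
  unfolding tc_map_def
proof (intro conjI \<eta>_linear allI image_subsetI)
  fix n x assume "x \<in> tc_deg sA A n"
  then show "\<eta> x \<in> tc_deg sB B (n + 1)"
  proof (rule free_linear_tc_deg[OF \<eta>_linear subspace_tc_deg tc_rel_tc_deg[OF \<eta>_tc_rel], rotated 2])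
    fix ns w assume w: "homogeneous_word A ns w" "tensor_degree ns = n"
    have "\<eta> (gen w) \<in> homogeneous_span B (tensor_degree ns + 1)"
      unfolding \<eta>_gen
      by (rule cofree_homotopy_homogeneous[OF _ _ _ w(1) order_refl])
         (simp_all add: twisted_\<phi>_degree h_component_degree \<psi>_component_degree)
    then show "\<eta> (gen w) \<in> tc_deg sB B (n + 1)" using w(2) by (simp add: homogeneous_span_tc_deg)
  qed
qed (rule \<eta>_tc_rel)

lemma tc_morphism_\<psi>: "tc_morphism sA A sB B \<psi>"
  by (simp add: tc_morphism_def map_\<psi> deconc_\<psi> tmap_tensor_map)

lemma tc_homotopy_\<eta>: "tc_homotopy sA A sB B \<phi> \<psi> \<eta>"
  using deconc_\<eta> by (simp add: tc_homotopy_def map_\<eta> tmap_tensor_map)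

definition defect :: "('a list \<Rightarrow>\<^sub>0 'r) \<Rightarrow> ('b list \<Rightarrow>\<^sub>0 'r)" where
  "defect x = (\<psi> x - \<phi> x) - (\<delta>B (\<eta> x) + \<eta> (\<delta>A x))"

lemma defect_linear: "free_linear defect"
  unfolding defect_def
  by (rule module_hom_minus[OF module_hom_minus[OF \<psi>_linear lin_\<phi>]
        module_hom_plus[OF module_hom_comp[OF \<eta>_linear lin_B] module_hom_comp[OF lin_A \<eta>_linear]]])

lemma defect_tc_rel: "x \<in> tc_rel sA \<Longrightarrow> defect x \<in> tc_rel sB"
  unfolding defect_def
  by (intro free.subspace_diff free.subspace_add \<psi>_tc_rel rel_\<phi> rel_B \<eta>_tc_rel rel_A) auto

lemma proj_defect: "tc_proj sB (defect x) = 0"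
  by (simp add: defect_def proj_B[THEN module_hom.diff] proj_B[THEN module_hom.add] proj_\<psi> proj_\<eta>)

text \<open>Apply \<open>\<delta>\<close> to the homotopy equation on the left and on the right, and use \<open>\<delta>\<^sup>2 = 0\<close>.\<close>

lemma \<psi>_chain_map_if_defect:
  assumes "defect x \<in> tc_rel sB" "defect (\<delta>A x) \<in> tc_rel sB"
  shows "\<delta>B (\<psi> x) - \<psi> (\<delta>A x) \<in> tc_rel sB"
proof -
  have "\<delta>B (\<psi> x) - \<psi> (\<delta>A x)
      = \<delta>B (defect x) - defect (\<delta>A x) + (\<delta>B (\<phi> x) - \<phi> (\<delta>A x)) + \<delta>B (\<delta>B (\<eta> x)) - \<eta> (\<delta>A (\<delta>A x))"
    by (simp add: defect_def lin_B[THEN module_hom.diff] lin_B[THEN module_hom.add] algebra_simps)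
  also have "\<dots> \<in> tc_rel sB"
    by (rule free.subspace_diff[OF subspace_tc_rel free.subspace_add[OF subspace_tc_rel
          free.subspace_add[OF subspace_tc_rel free.subspace_diff[OF subspace_tc_rel
              rel_B[OF assms(1)] assms(2)] chain_map] square_B] \<eta>_tc_rel[OF square_A]])
  finally show ?thesis .
qed

text \<open>Expansion of \<open>(\<delta> \<otimes> 1 + S \<otimes> \<delta>) (\<phi> S \<otimes> \<eta> + \<eta> \<otimes> \<psi>) \<Delta>\<close>.\<close>

lemma deconc_\<delta>B_\<eta>:
  "deconc (\<delta>B (\<eta> (gen w))) - (\<Sum>i = 1..<length w.
      tens (\<delta>B (\<phi> (sign_map A (gen (take i w))))) (\<eta> (gen (drop i w)))
    + tens (\<delta>B (\<eta> (gen (take i w)))) (\<psi> (gen (drop i w)))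
    + tens (sign_map B (\<phi> (sign_map A (gen (take i w))))) (\<delta>B (\<eta> (gen (drop i w))))
    + tens (sign_map B (\<eta> (gen (take i w)))) (\<delta>B (\<psi> (gen (drop i w))))) \<in> tc2_rel sB"
proof -
  let ?E = "tensor_map (\<lambda>x. \<phi> (sign_map A x)) \<eta> (deconc (gen w)) + tensor_map \<eta> \<psi> (deconc (gen w))"
  note T = tensor_map_linear[THEN module_hom.diff] tensor_map_linear[THEN module_hom.add]
    tensor_map_linear[THEN module_hom.sum]
  have 1: "tensor_map \<delta>B id (deconc (\<eta> (gen w)) - ?E) \<in> tc2_rel sB"
    by (rule tensor_map_tc2_rel[OF lin_B free.module_hom_id _ _ deconc_\<eta>]) (auto intro: rel_B)
  have 2: "tensor_map (sign_map B) \<delta>B (deconc (\<eta> (gen w)) - ?E) \<in> tc2_rel sB"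
    by (rule tensor_map_tc2_rel[OF sign_map_linear lin_B _ _ deconc_\<eta>])
       (auto intro: rel_B sign_map_tc_rel B.graded_module_axioms)
  from free.subspace_add[OF subspace_tc2_rel free.subspace_add[OF subspace_tc2_rel
        coderivation_deconc[OF coder_B, of "\<eta> (gen w)"] 1] 2]
  show ?thesis
    unfolding T tensor_map_deconc_gen
    by (simp add: tensor_map_tens lin_B free.module_hom_id sign_map_linear sum.distrib algebra_simps
        del: sign_map_gen)
qed

text \<open>Expansion of \<open>(\<phi> S \<otimes> \<eta> + \<eta> \<otimes> \<psi>) (\<delta> \<otimes> 1 + S \<otimes> \<delta>) \<Delta>\<close>, with \<open>S\<^sup>2 = 1\<close>.\<close>

lemma deconc_\<eta>_\<delta>A:
  "deconc (\<eta> (\<delta>A (gen w))) - (\<Sum>i = 1..<length w.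
      tens (\<phi> (sign_map A (\<delta>A (gen (take i w))))) (\<eta> (gen (drop i w)))
    + tens (\<phi> (gen (take i w))) (\<eta> (\<delta>A (gen (drop i w))))
    + tens (\<eta> (\<delta>A (gen (take i w)))) (\<psi> (gen (drop i w)))
    + tens (\<eta> (sign_map A (gen (take i w)))) (\<psi> (\<delta>A (gen (drop i w))))) \<in> tc2_rel sB"
proof -
  let ?E = "tensor_map \<delta>A id (deconc (gen w)) + tensor_map (sign_map A) \<delta>A (deconc (gen w))"
  note T = tensor_map_linear[THEN module_hom.diff] tensor_map_linear[THEN module_hom.add]
    tensor_map_linear[THEN module_hom.sum]
  have 1: "tensor_map (\<lambda>x. \<phi> (sign_map A x)) \<eta> (deconc (\<delta>A (gen w)) - ?E) \<in> tc2_rel sB"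
    by (rule tensor_map_tc2_rel[OF \<phi>_sign_linear \<eta>_linear _ _ coderivation_deconc[OF coder_A]])
       (auto intro: \<phi>_sign_tc_rel \<eta>_tc_rel)
  have 2: "tensor_map \<eta> \<psi> (deconc (\<delta>A (gen w)) - ?E) \<in> tc2_rel sB"
    by (rule tensor_map_tc2_rel[OF \<eta>_linear \<psi>_linear _ _ coderivation_deconc[OF coder_A]])
       (auto intro: \<psi>_tc_rel \<eta>_tc_rel)
  from free.subspace_add[OF subspace_tc2_rel free.subspace_add[OF subspace_tc2_rel
        deconc_\<eta>[of "\<delta>A (gen w)"] 1] 2]
  show ?thesis
    unfolding T tensor_map_deconc_gen
    by (simp add: tensor_map_tens \<phi>_sign_linear \<eta>_linear \<psi>_linear sum.distrib algebra_simps
        sign_map_involutive[OF A.graded_module_axioms] del: sign_map_gen)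
qed

text \<open>The projection of the defect is zero by construction of \<open>\<psi>\<close>. Its coproduct is expanded over
  the cuts of the word; the contribution \<open>R i\<close> of each cut is shown to vanish by induction.\<close>

lemma defect_gen: "defect (gen w) \<in> tc_rel sB"
proof (induction w rule: length_induct)
  case (1 w)
  have shorter: "defect x \<in> tc_rel sB" if "x \<in> length_filtration sA m" "m < length w" for x m
    using that 1 by (intro free_linear_length_filtration[OF defect_linear subspace_tc_rel defect_tc_rel _ that(1)]) auto
  define R where "R i =
      tens (\<psi> (gen (take i w))) (\<psi> (gen (drop i w))) - tens (\<phi> (gen (take i w))) (\<phi> (gen (drop i w)))
    - (tens (\<delta>B (\<phi> (sign_map A (gen (take i w))))) (\<eta> (gen (drop i w)))
      + tens (\<delta>B (\<eta> (gen (take i w)))) (\<psi> (gen (drop i w)))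
      + tens (sign_map B (\<phi> (sign_map A (gen (take i w))))) (\<delta>B (\<eta> (gen (drop i w))))
      + tens (sign_map B (\<eta> (gen (take i w)))) (\<delta>B (\<psi> (gen (drop i w)))))
    - (tens (\<phi> (sign_map A (\<delta>A (gen (take i w))))) (\<eta> (gen (drop i w)))
      + tens (\<phi> (gen (take i w))) (\<eta> (\<delta>A (gen (drop i w))))
      + tens (\<eta> (\<delta>A (gen (take i w)))) (\<psi> (gen (drop i w)))
      + tens (\<eta> (sign_map A (gen (take i w)))) (\<psi> (\<delta>A (gen (drop i w)))))" for i
  have "R i \<in> tc2_rel sB" if i: "i \<in> {1..<length w}" for i
  proof -
    define u v where "u = (gen (take i w) :: 'a list \<Rightarrow>\<^sub>0 'r)" and "v = (gen (drop i w) :: 'a list \<Rightarrow>\<^sub>0 'r)"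
    let ?S = "sign_map A" and ?T = "sign_map B"
    have u: "defect u \<in> tc_rel sB"
      unfolding u_def by (rule shorter[of _ i]) (use i in \<open>auto intro: gen_length_filtration\<close>)
    have vF: "v \<in> length_filtration sA (length w - i)"
      unfolding v_def by (rule gen_length_filtration) simp
    have v: "defect v \<in> tc_rel sB"
      by (rule shorter[OF vF]) (use i in auto)
    have "defect (\<delta>A v) \<in> tc_rel sB"
      by (rule shorter[OF coderivation_length_filtration[OF A.module_axioms coder_A vF]]) (use i in auto)
    then have r4: "\<delta>B (\<psi> v) - \<psi> (\<delta>A v) \<in> tc_rel sB"
      by (rule \<psi>_chain_map_if_defect[OF v])
    have "\<phi> (?S (\<delta>A u) + \<delta>A (?S u)) \<in> tc_rel sB"
      using rel_\<phi>[OF tc_map_sign[OF A.graded_module_axioms A.graded_module_axioms map_A, of u]]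
      by (simp add: signed_def)
    from free.subspace_add[OF subspace_tc_rel chain_map[of "?S u"] this]
    have r1: "\<delta>B (\<phi> (?S u)) + \<phi> (?S (\<delta>A u)) \<in> tc_rel sB"
      by (simp add: lin_\<phi>[THEN module_hom.add])
    have r2: "?T (\<phi> (?S u)) - \<phi> u \<in> tc_rel sB"
      using tc_map_sign[OF A.graded_module_axioms B.graded_module_axioms map_\<phi>, of "?S u"]
      by (simp add: sign_map_involutive[OF A.graded_module_axioms])
    have r3: "?T (\<eta> u) + \<eta> (?S u) \<in> tc_rel sB"
      using tc_map_sign[OF A.graded_module_axioms B.graded_module_axioms map_\<eta>, of u]
      by (simp add: signed_def)
    \<comment> \<open>The four relations collected so far say that \<open>\<delta> \<phi> S = - \<phi> S \<delta>\<close>, \<open>S \<phi> S = \<phi>\<close> and \<open>S \<eta> = - \<eta> S\<close>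
      on \<open>u\<close> and \<open>\<delta> \<psi> = \<psi> \<delta>\<close> on \<open>v\<close>. The rest of \<open>R i\<close> is \<open>\<psi> \<otimes> \<psi> - \<phi> \<otimes> \<phi> - \<phi> \<otimes> (\<psi> - \<phi>) - (\<psi> - \<phi>) \<otimes> \<psi> = 0\<close>,
      up to the defects of \<open>u\<close> and \<open>v\<close>.\<close>
    have "R i = tens (\<phi> u) (defect v) + tens (defect u) (\<psi> v) - tens (\<delta>B (\<phi> (?S u)) + \<phi> (?S (\<delta>A u))) (\<eta> v)
      - tens (?T (\<phi> (?S u)) - \<phi> u) (\<delta>B (\<eta> v)) - tens (?T (\<eta> u) + \<eta> (?S u)) (\<delta>B (\<psi> v))
      + tens (\<eta> (?S u)) (\<delta>B (\<psi> v) - \<psi> (\<delta>A v))"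
      unfolding R_def u_def[symmetric] v_def[symmetric] defect_def
      by (simp add: tens_simps algebra_simps)
    also have "\<dots> \<in> tc2_rel sB"
      by (rule free.subspace_add[OF subspace_tc2_rel free.subspace_diff[OF subspace_tc2_rel
            free.subspace_diff[OF subspace_tc2_rel free.subspace_diff[OF subspace_tc2_rel
              free.subspace_add[OF subspace_tc2_rel tens_tc2_right[OF v] tens_tc2_left[OF u]]
              tens_tc2_left[OF r1]] tens_tc2_left[OF r2]] tens_tc2_left[OF r3]] tens_tc2_right[OF r4]])
    finally show ?thesis .
  qed
  then have R: "(\<Sum>i = 1..<length w. R i) \<in> tc2_rel sB"
    by (rule free.subspace_sum[OF subspace_tc2_rel])
  note N = free.subspace_diff[OF subspace_tc2_rel]
  from free.subspace_add[OF subspace_tc2_rel N[OF N[OF N[OF deconc_\<psi>[of "gen w"]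
          morphism_deconc[OF morphism, of "gen w"]] deconc_\<delta>B_\<eta>[of w]] deconc_\<eta>_\<delta>A[of w]] R]
  have "deconc (defect (gen w)) \<in> tc2_rel sB"
    unfolding tensor_map_deconc_gen
    by (simp add: defect_def R_def deconc_linear[THEN module_hom.diff] deconc_linear[THEN module_hom.add]
        sum.distrib sum_subtractf algebra_simps del: sign_map_gen)
  then show ?case
    by (rule tc_rel_if_deconc_proj[OF B.module_axioms]) (rule proj_defect)
qed

lemma defect_zero: "defect x \<in> tc_rel sB"
  by (rule free_linear_mem[OF defect_linear subspace_tc_rel defect_gen])

lemma homotopy_\<eta>: "(\<psi> x - \<phi> x) - (\<delta>B (\<eta> x) + \<eta> (\<delta>A x)) \<in> tc_rel sB"
  using defect_zero[of x] by (simp only: defect_def)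

lemma chain_map_\<psi>: "\<delta>B (\<psi> x) - \<psi> (\<delta>A x) \<in> tc_rel sB"
  by (rule \<psi>_chain_map_if_defect[OF defect_zero defect_zero])

end

section \<open>Multilinear components of maps of tensor coalgebras\<close>

text \<open>The sign of \<open>\<down>\<^bsup>\<otimes>k\<^esup>\<close>, realised by operators on the letters so that it makes sense, and is
  multilinear, on words that are not homogeneous.\<close>

fun desuspend :: "(int \<Rightarrow> 'a::ab_group_add set) \<Rightarrow> 'a list \<Rightarrow> 'a list" where
  "desuspend A [] = []"
| "desuspend A (x # xs) = ((\<lambda>a. - parity A a) ^^ length xs) x # desuspend A xs"

fun desusp_signs :: "int list \<Rightarrow> int list" where
  "desusp_signs [] = []"
| "desusp_signs (n # ns) = int (length ns) * (n + 1) # desusp_signs ns"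

lemma sum_list_desusp_signs: "sum_list (desusp_signs ns) = desusp_exponent ns"
proof (induction ns)
  case (Cons n ns)
  then show ?case
    by (simp add: desusp_exponent_def sum.lessThan_Suc_shift del: sum.lessThan_Suc)
qed (simp add: desusp_exponent_def)

lemma length_desusp_signs [simp]: "length (desusp_signs ns) = length ns"
  by (induction ns) auto

lemma (in graded_module) funpow_parity_homogeneous:
  assumes "x \<in> A n"
  shows "((\<lambda>a. - parity A a) ^^ k) x = signed (int k * (n + 1)) x"
proof (induction k)
  case (Suc k)
  have "signed (int k * (n + 1)) x \<in> A n"
    by (rule signed_mem[OF module_axioms homogeneous_subspace assms])
  then have "- parity A (signed (int k * (n + 1)) x) = signed (n + 1) (signed (int k * (n + 1)) x)"
    by (simp add: parity_homogeneous) (simp add: signed_def)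
  then show ?case
    using Suc by (simp add: signed_add[symmetric] algebra_simps)
qed simp

lemma desuspend_homogeneous:
  assumes "graded_module s A" "homogeneous_word A ns xs"
  shows "gen (desuspend A xs) - signed (desusp_exponent ns) (gen xs) \<in> tc_rel s"
proof -
  interpret graded_module s A by fact
  have "desuspend A xs = map2 signed (desusp_signs ns) xs"
    using assms(2)
  proof (induction xs arbitrary: ns)
    case (Cons x xs)
    then obtain n ms where "ns = n # ms" "x \<in> A n" "homogeneous_word A ms xs"
      by (auto simp: homogeneous_word_Cons)
    with Cons.IH[of ms] show ?case
      by (simp add: funpow_parity_homogeneous homogeneous_word_length)
  qed simp
  then show ?thesis
    using gen_signed_letters[OF module_axioms, of "desusp_signs ns" xs]
    by (simp add: sum_list_desusp_signs homogeneous_word_length[OF assms(2)])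
qed

lemma desuspend_letter:
  "\<exists>us. \<forall>x. desuspend A (xs @ [x] @ ys) = us @ [((\<lambda>a. - parity A a) ^^ length ys) x] @ desuspend A ys"
proof (induction xs)
  case Nil
  show ?case by (rule exI[of _ "[]"]) simp
next
  case (Cons a xs)
  then obtain us where us: "\<forall>x. desuspend A (xs @ [x] @ ys)
      = us @ [((\<lambda>a. - parity A a) ^^ length ys) x] @ desuspend A ys" by blast
  show ?case
    by (rule exI[of _ "((\<lambda>a. - parity A a) ^^ (length xs + 1 + length ys)) a # us"]) (use us in simp)
qed

lemma multilinear_if_kills_relations:
  assumes "module sA" "module_hom fscale sB T" "\<And>x. x \<in> tc_rel sA \<Longrightarrow> T x = 0"
  shows "module_hom sA sB (\<lambda>x. T (gen (xs @ [x] @ ys)))"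
proof -
  note L = assms(2)[THEN module_hom.diff] assms(2)[THEN module_hom.add] assms(2)[THEN module_hom.scale]
  have "T (gen (xs @ [x + y] @ ys)) = T (gen (xs @ [x] @ ys)) + T (gen (xs @ [y] @ ys))" for x y
    using assms(3)[OF tc_rel_add_letter[of xs x y ys sA]] by (simp add: L algebra_simps)
  moreover have "T (gen (xs @ [sA c x] @ ys)) = sB c (T (gen (xs @ [x] @ ys)))" for c x
    using assms(3)[OF tc_rel_scale_letter[of xs sA c x ys]] by (simp add: L)
  ultimately show ?thesis
    using assms(1,2) by (simp add: module_hom_iff)
qed

lemma (in graded_module) funpow_parity_linear: "module_hom s s ((\<lambda>a. - parity A a) ^^ k)"
proof (induction k)
  case (Suc k)
  show ?case
    using module_hom_negate[OF module_hom_comp[OF Suc parity_linear]] by (simp add: o_def)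
qed (simp add: id_def module_hom_identity module_axioms)

text \<open>Every map of tensor coalgebras of some degree \<open>d\<close> has multilinear components. They are obtained
  by desuspending the word first, because on homogeneous words desuspension is a sign and hence its
  own inverse.\<close>

lemma components_of_tc_map:
  assumes A: "graded_module sA A" and B: "graded_module sB B" and \<theta>: "tc_map sA A sB B d \<theta>"
  defines "m \<equiv> \<lambda>k xs. tc_proj sB (\<theta> (gen (desuspend A xs)))"
  shows "graded_multilinear sA A sB B k (int k + d - 1) (m k)"
    and "homogeneous_word A ns xs \<Longrightarrow> tc_proj sB (\<theta> (gen xs)) = signed (desusp_exponent ns) (m (length xs) xs)"
proof -
  interpret A: graded_module sA A by fact
  interpret B: graded_module sB B by fact
  note lin = module_hom_comp[OF tc_map_linear[OF \<theta>] tc_proj_linear[OF B.module_axioms]]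
  have kills: "tc_proj sB (\<theta> x) = 0" if "x \<in> tc_rel sA" for x
    by (rule tc_proj_tc_rel[OF B.module_axioms tc_map_tc_rel[OF \<theta> that]])
  have m: "m k xs = signed (desusp_exponent ns) (tc_proj sB (\<theta> (gen xs)))"
    if "homogeneous_word A ns xs" for ns xs k
    using kills[OF desuspend_homogeneous[OF A that]]
    by (simp add: m_def lin[THEN module_hom.diff] module_hom_signed[OF lin])
  show "tc_proj sB (\<theta> (gen xs)) = signed (desusp_exponent ns) (m (length xs) xs)"
    if "homogeneous_word A ns xs"
    by (simp add: m[OF that])
  show "graded_multilinear sA A sB B k (int k + d - 1) (m k)"
    unfolding graded_multilinear_def
  proof (intro conjI allI impI)
    fix xs ys
    obtain us where us: "\<forall>x. desuspend A (xs @ [x] @ ys)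
        = us @ [((\<lambda>a. - parity A a) ^^ length ys) x] @ desuspend A ys"
      using desuspend_letter by blast
    show "module_hom sA sB (\<lambda>x. m k (xs @ [x] @ ys))"
      unfolding m_def us[rule_format]
      by (rule module_hom_comp[OF A.funpow_parity_linear
            multilinear_if_kills_relations[OF A.module_axioms lin kills]])
  next
    fix ns xs assume k: "length xs = k" and xs: "homogeneous_word A ns xs"
    have "tc_proj sB (\<theta> (gen xs)) \<in> B (tensor_degree ns + d - 1)"
      by (intro tc_proj_tc_deg[OF B] tc_map_tc_deg[OF \<theta>] homogeneous_span_tc_deg gen_homogeneous_span xs)
    moreover have "tensor_degree ns = sum_list ns + int (length ns)" for ns
      by (induction ns) auto
    ultimately have "tc_proj sB (\<theta> (gen xs)) \<in> B (sum_list ns + (int k + d - 1))"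
      using homogeneous_word_length[OF xs] k by (simp add: algebra_simps)
    then show "m k xs \<in> B (sum_list ns + (int k + d - 1))"
      unfolding m[OF xs] by (rule signed_mem[OF B.module_axioms B.homogeneous_subspace])
  qed
qed

text \<open>Two coderivations with the same components agree modulo relations, so that vanishing of the square
  can be transferred from one to the other.\<close>

lemma determined_coderivation_square:
  assumes "graded_module s A" "determined_coderivation s A d \<mu> \<delta>" "determined_coderivation s A d \<mu> \<delta>'"
    "\<And>x. \<delta>' (\<delta>' x) \<in> tc_rel s"
  shows "\<delta> (\<delta> x) \<in> tc_rel s"
proof -
  interpret graded_module s A by fact
  have \<delta>: "tc_coderivation s A \<delta>" "has_components A s \<delta> (family d \<mu>)"
    and \<delta>': "tc_coderivation s A \<delta>'" "has_components A s \<delta>' (family d \<mu>)"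
    using assms(2,3) by (simp_all add: determined_coderivation_def)
  have maps: "tc_map s A s A (-1) \<delta>" "tc_map s A s A (-1) \<delta>'"
    using \<delta>(1) \<delta>'(1) by (simp_all add: tc_coderivation_def)
  have unique: "\<delta> x - \<delta>' x \<in> tc_rel s" for x
    by (rule coderivation_unique[OF assms(1) \<delta>(1) \<delta>'(1)
          has_components_proj_eq[OF assms(1) module_axioms maps \<delta>(2) \<delta>'(2)]])
  have "(\<delta> (\<delta> x) - \<delta>' (\<delta> x)) + \<delta>' (\<delta> x - \<delta>' x) + \<delta>' (\<delta>' x) \<in> tc_rel s"
    by (rule free.subspace_add[OF subspace_tc_rel free.subspace_add[OF subspace_tc_rel unique
            tc_map_tc_rel[OF maps(2) unique]] assms(4)])
  then show ?thesis
    by (simp add: tc_map_linear[OF maps(2), THEN module_hom.diff])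
qed

lemma has_components_letter:
  assumes "has_components A sB \<theta> (family f fs)" "a \<in> A n"
  shows "tc_proj sB (\<theta> (gen [a])) = f a"
  using assms(1)[unfolded has_components_def, rule_format, of "[a]" "[n]"] assms(2)
  by (simp add: family_def desusp_exponent_def)

theorem lemma3:
  fixes sA :: "'r::comm_ring_1 \<Rightarrow> 'a::ab_group_add \<Rightarrow> 'a"
    and sB :: "'r \<Rightarrow> 'b::ab_group_add \<Rightarrow> 'b"
    and A :: "int \<Rightarrow> 'a set" and B :: "int \<Rightarrow> 'b set"
    and dA :: "'a \<Rightarrow> 'a" and dB :: "'b \<Rightarrow> 'b"
    and \<mu>A :: "nat \<Rightarrow> 'a list \<Rightarrow> 'a" and \<mu>B :: "nat \<Rightarrow> 'b list \<Rightarrow> 'b"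
    and f g :: "'a \<Rightarrow> 'b" and fs :: "nat \<Rightarrow> 'a list \<Rightarrow> 'b"
  assumes "A_inf_algebra sA A dA \<mu>A"
    and "A_inf_algebra sB B dB \<mu>B"
    and "A_inf_morphism sA A dA \<mu>A sB B dB \<mu>B f fs"
    and "chain_map sA A dA sB B dB g"
    and "chain_homotopic sA A dA sB B dB g f"
  shows "\<exists>gs. A_inf_morphism sA A dA \<mu>A sB B dB \<mu>B g gs \<and>
           (\<exists>h hs. A_inf_homotopy sA A dA \<mu>A sB B dB \<mu>B g gs f fs h hs)"
proof -
  have A: "graded_module sA A" and B: "graded_module sB B"
    using assms(1,2) by (simp_all add: A_inf_algebra_def chain_complex_def)
  \<comment> \<open>The maps that witness the two algebra structures need not be the ones that witness the
    morphism. The latter are kept, and their squares vanish by uniqueness.\<close>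
  obtain \<delta>A' where \<delta>A': "determined_coderivation sA A dA \<mu>A \<delta>A'" "\<And>x. \<delta>A' (\<delta>A' x) \<in> tc_rel sA"
    using assms(1) by (auto simp: A_inf_algebra_def)
  obtain \<delta>B' where \<delta>B': "determined_coderivation sB B dB \<mu>B \<delta>B'" "\<And>x. \<delta>B' (\<delta>B' x) \<in> tc_rel sB"
    using assms(2) by (auto simp: A_inf_algebra_def)
  obtain \<delta>A \<delta>B \<phi> where \<delta>A: "determined_coderivation sA A dA \<mu>A \<delta>A"
    and \<delta>B: "determined_coderivation sB B dB \<mu>B \<delta>B"
    and \<phi>: "determined_morphism sA A sB B f fs \<phi>"
    and comm: "\<And>x. \<delta>B (\<phi> x) - \<phi> (\<delta>A x) \<in> tc_rel sB"
    using assms(3) by (auto simp: A_inf_morphism_def)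
  obtain h where h: "graded_map sA A sB B 1 h" "\<And>x. g x - f x = dB (h x) + h (dA x)"
    using assms(5) by (auto simp: chain_homotopic_def)
  interpret homotopy_extension sA A sB B \<delta>A \<delta>B \<phi> h
  proof (intro homotopy_extension.intro homotopy_extension_axioms.intro A B)
    show "tc_coderivation sA A \<delta>A" "tc_coderivation sB B \<delta>B" "tc_morphism sA A sB B \<phi>"
      using \<delta>A \<delta>B \<phi> by (simp_all add: determined_coderivation_def determined_morphism_def)
  qed (fact comm h determined_coderivation_square[OF A \<delta>A \<delta>A'] determined_coderivation_square[OF B \<delta>B \<delta>B'])+
  define gs where "gs k xs = tc_proj sB (\<psi> (gen (desuspend A xs)))" for k :: nat and xs
  define hs :: "nat \<Rightarrow> 'a list \<Rightarrow> 'b" where "hs k xs = 0" for k xs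
  have comps: "has_components A sA \<delta>A (family dA \<mu>A)" "has_components A sB \<phi> (family f fs)"
    "has_components B sB \<delta>B (family dB \<mu>B)"
    using \<delta>A \<delta>B \<phi> by (simp_all add: determined_coderivation_def determined_morphism_def)
  have linear_part: "tc_proj sB (\<psi> (gen [a])) = g a" if a: "a \<in> A n" for a n
  proof -
    have "\<eta> (gen [a]) = gen [h a]"
      by (simp add: \<eta>_gen cofree_homotopy.simps[of _ _ _ "[a]"] h_component_def
          tc_proj_gen[OF A.module_axioms] attach_linear[THEN module_hom.zero])
    then show ?thesis
      using h(2)[of a] has_components_letter[OF comps(1) a] has_components_letter[OF comps(2) a]
        has_components_letter[OF comps(3) h_degree[OF a]]
      by (simp add: proj_\<psi> algebra_simps)
  qed
  have \<psi>_comps: "has_components A sB \<psi> (family g gs)"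
    unfolding has_components_def
  proof (intro allI impI)
    fix ns xs assume xs: "xs \<noteq> []" "homogeneous_word A ns xs"
    show "tc_proj sB (\<psi> (gen xs)) = (if even (desusp_exponent ns)
        then family g gs (length xs) xs else - family g gs (length xs) xs)"
    proof (cases "length xs = 1")
      case True
      then obtain a n where "xs = [a]" "ns = [n]" "a \<in> A n"
        using xs by (cases xs) (auto simp: homogeneous_word_Cons)
      then show ?thesis using linear_part by (simp add: family_def desusp_exponent_def)
    next
      case False
      then show ?thesis
        using components_of_tc_map(2)[OF A B map_\<psi> xs(2)] by (simp add: family_def gs_def signed_def)
    qed
  qed
  have \<eta>_comps: "has_components A sB \<eta> (family h hs)"
    unfolding has_components_def
  proof (intro allI impI)
    fix ns xs assume xs: "xs \<noteq> []" "homogeneous_word A ns xs"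
    show "tc_proj sB (\<eta> (gen xs)) = (if even (desusp_exponent ns)
        then family h hs (length xs) xs else - family h hs (length xs) xs)"
    proof (cases "length xs = 1")
      case True
      then obtain a n where "xs = [a]" "ns = [n]" "a \<in> A n"
        using xs by (cases xs) (auto simp: homogeneous_word_Cons)
      then show ?thesis
        by (simp add: family_def desusp_exponent_def proj_\<eta> tc_proj_gen[OF A.module_axioms])
    next
      case False
      then show ?thesis
        by (simp add: family_def hs_def proj_\<eta> tc_proj_gen[OF A.module_axioms] h_linear[THEN module_hom.zero])
    qed
  qed
  have \<psi>: "determined_morphism sA A sB B g gs \<psi>"
    by (simp add: determined_morphism_def tc_morphism_\<psi> \<psi>_comps)
  have "A_inf_morphism sA A dA \<mu>A sB B dB \<mu>B g gs"
    unfolding A_inf_morphism_def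
  proof (intro conjI allI impI)
    show "graded_map sA A sB B 0 g" using assms(4) by (simp add: chain_map_def)
    show "graded_multilinear sA A sB B k (int k - 1) (gs k)" for k
      using components_of_tc_map(1)[OF A B map_\<psi>, of k] by (simp add: gs_def[abs_def])
    show "\<exists>\<delta>A \<delta>B \<phi>. determined_coderivation sA A dA \<mu>A \<delta>A \<and> determined_coderivation sB B dB \<mu>B \<delta>B \<and>
        determined_morphism sA A sB B g gs \<phi> \<and> (\<forall>x. \<delta>B (\<phi> x) - \<phi> (\<delta>A x) \<in> tc_rel sB)"
      using \<delta>A \<delta>B \<psi> chain_map_\<psi> by blast
  qed
  moreover have "A_inf_homotopy sA A dA \<mu>A sB B dB \<mu>B g gs f fs h hs"
    unfolding A_inf_homotopy_def
  proof (intro conjI allI impI)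
    show "graded_map sA A sB B 1 h" by (fact h)
    show "graded_multilinear sA A sB B k (int k) (hs k)" for k
      by (simp add: graded_multilinear_def hs_def B.subspace_0[OF B.homogeneous_subspace]
          module_hom_const_zero A.module_axioms B.module_axioms)
    show "\<exists>\<delta>A \<delta>B \<phi> \<psi> \<eta>. determined_coderivation sA A dA \<mu>A \<delta>A \<and> determined_coderivation sB B dB \<mu>B \<delta>B \<and>
        determined_morphism sA A sB B f fs \<phi> \<and> determined_morphism sA A sB B g gs \<psi> \<and>
        tc_homotopy sA A sB B \<phi> \<psi> \<eta> \<and> has_components A sB \<eta> (family h hs) \<and>
        (\<forall>x. (\<psi> x - \<phi> x) - (\<delta>B (\<eta> x) + \<eta> (\<delta>A x)) \<in> tc_rel sB)"
      using \<delta>A \<delta>B \<phi> \<psi> tc_homotopy_\<eta> \<eta>_comps homotopy_\<eta> by blast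
  qed
  ultimately show ?thesis by blast
qed

end
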